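(* If $G$ is a cubic ($3$-regular) graph of order $n$, then $\gamma^{NN}_{s}(G)\le n/3$.
   Context: All graphs are finite and simple. For a vertex $v$, $N[v]=N(v)\cup\{v\}$; for $f:V(G)\to\mathbb{R}$ and $S\subseteq V(G)$, $f(S)=\sum_{v\in S}f(v)$. A nonnegative signed dominating function (NNSDF) of $G$ is a function $f:V(G)\to\{-1,1\}$ with $f(N[v])\ge 0$ for every $v\in V(G)$; $\gamma^{NN}_s(G)$ is the minimum of $f(V(G))$ over all NNSDFs $f$ of $G$. *)

theory Defs
  imports Complex_Main "HOL-Library.FuncSet" "Graph_Theory.Pair_Digraph"
begin

(* A finite simple graph is a pair_graph: finite, loop-free and with a symmetric set of
   arcs, each edge {u, v} being represented by the two arcs (u, v) and (v, u). *)

definition open_nbhd :: "'a pair_pre_digraph \<Rightarrow> 'a \<Rightarrow> 'a set" where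
  "open_nbhd G v = {u. (v, u) \<in> parcs G}"

definition closed_nbhd :: "'a pair_pre_digraph \<Rightarrow> 'a \<Rightarrow> 'a set" where
  "closed_nbhd G v = open_nbhd G v \<union> {v}"

(* By symmetry of the arcs, out_degree is the usual degree; see out_degree_eq_card_open_nbhd. *)
definition regular :: "nat \<Rightarrow> 'a pair_pre_digraph \<Rightarrow> bool" where
  "regular k G \<longleftrightarrow> (\<forall>v \<in> pverts G. out_degree (with_proj G) v = k)"

(* A function on the vertex set is a total function whose values off the vertex set
   are irrelevant: both conditions only involve values at vertices. *)
definition nnsdf :: "'a pair_pre_digraph \<Rightarrow> ('a \<Rightarrow> real) \<Rightarrow> bool" where
  "nnsdf G f \<longleftrightarrow> f \<in> pverts G \<rightarrow> {-1, 1} \<and> (\<forall>v \<in> pverts G. sum f (closed_nbhd G v) \<ge> 0)"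

(* For a finite graph this is a minimum over a finite nonempty set of weights;
   see nnsd_number_attained and nnsd_number_le. *)
definition nnsd_number :: "'a pair_pre_digraph \<Rightarrow> real" where
  "nnsd_number G = Min {sum f (pverts G) | f. nnsdf G f}"

lemma out_degree_eq_card_open_nbhd:
  "out_degree (with_proj G) v = card (open_nbhd G v)"
proof -
  have "out_arcs (with_proj G) v = Pair v ` open_nbhd G v"
    by (auto simp: out_arcs_def open_nbhd_def)
  then show ?thesis
    by (simp add: out_degree_def card_image inj_on_def)
qed

lemma finite_nnsdf_weights:
  assumes "pair_graph G"
  shows "finite {sum f (pverts G) | f. nnsdf G f}"
proof -
  interpret pair_graph G by fact
  let ?F = "pverts G \<rightarrow>\<^sub>E {-1, 1 :: real}"
  have "{sum f (pverts G) | f. nnsdf G f} \<subseteq> (\<lambda>f. sum f (pverts G)) ` ?F"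
  proof
    fix x assume "x \<in> {sum f (pverts G) | f. nnsdf G f}"
    then obtain f where f: "nnsdf G f" "x = sum f (pverts G)" by blast
    then have "restrict f (pverts G) \<in> ?F" by (auto simp: nnsdf_def)
    moreover have "x = sum (restrict f (pverts G)) (pverts G)" using f by simp
    ultimately show "x \<in> (\<lambda>f. sum f (pverts G)) ` ?F" by blast
  qed
  moreover have "finite ?F" by (intro finite_PiE pair_finite_verts) simp
  ultimately show ?thesis by (meson finite_imageI finite_subset)
qed

lemma nnsdf_const_one: "nnsdf G (\<lambda>_. 1)"
  by (simp add: nnsdf_def)

lemma nnsd_number_attained:
  assumes "pair_graph G"
  shows "\<exists>f. nnsdf G f \<and> sum f (pverts G) = nnsd_number G"
proof -
  have "{sum f (pverts G) | f. nnsdf G f} \<noteq> {}"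
    using nnsdf_const_one by blast
  from Min_in[OF finite_nnsdf_weights[OF assms] this]
  show ?thesis unfolding nnsd_number_def by force
qed

lemma nnsd_number_le:
  assumes "pair_graph G" "nnsdf G f"
  shows "nnsd_number G \<le> sum f (pverts G)"
  unfolding nnsd_number_def
  using assms by (intro Min_le finite_nnsdf_weights) auto

end

(* If the vertices of G are coloured with three colours so that no closed neighbourhood contains
   three vertices of the same colour, then giving the value -1 to a largest colour class and 1 to
   all other vertices is an NNSDF of weight at most n - 2n/3.

   Such a colouring exists for every graph of maximum degree at most 3, by induction on the number
   of vertices. If at most one edge joins Q and V - Q, colour both parts and match the colourings
   at the two ends of that edge by permuting colours. Otherwise Tutte's theorem yields a matching
   m that covers all vertices of degree 3: an odd set of such vertices is left by an odd number of
   edges, hence by at least three. Each N[v] then splits into {v, m v} and the pair of the other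
   neighbours of v. The graph H with all these pairs as edges has maximum degree at most 3 because
   {v, m v} is a pair of both N[v] and N[m v], and a proper 3-colouring of H is as required. Brooks'
   theorem provides one unless H contains a K4. The edges of a K4 of H are two matching edges and
   four pairs of other neighbours. It suffices to colour the rest of H properly, and to recolour
   inside the K4 so that one of these four pairs {p, r}, coming from N[x] say, is monochromatic in
   a colour not used on x and m x; when x lies in a K4 of H as well, the graph has just eight
   vertices and is coloured explicitly. *)

theory Submission
  imports Defs "HOL-Combinatorics.Transposition"
begin

section \<open>Brooks' theorem for maximum degree three\<close>

datatype colour = Red | Green | Blue

lemma UNIV_colour: "UNIV = {Red, Green, Blue}"
  using colour.exhaust by auto

instance colour :: finite
  by standard (simp add: UNIV_colour)

lemma ex_colour_notin:
  assumes "card (S :: colour set) \<le> 2"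
  shows "\<exists>k. k \<notin> S"
proof (rule ccontr)
  assume "\<not> ?thesis"
  then have "S = UNIV" by auto
  with assms show False by (simp add: UNIV_colour)
qed

lemma ex_colour_neq2: "\<exists>k. k \<noteq> i \<and> k \<noteq> (j :: colour)"
  using ex_colour_notin[of "{i, j}"] card_insert_le_m1[of 2 "{j}" i] by auto

lemma ex_three_colours: "\<exists>k l. k \<noteq> t \<and> l \<noteq> t \<and> k \<noteq> (l :: colour)"
  by (cases t) (use colour.distinct in blast)+

lemma ex_inj_map1: "\<exists>\<sigma> :: 'b \<Rightarrow> 'b. inj \<sigma> \<and> \<sigma> x = y"
  by (rule exI[of _ "transpose x y"]) simp

text \<open>After the transposition of \<open>x\<close> and \<open>x'\<close>, the image
  \<open>z\<close> of \<open>y\<close> differs from \<open>x'\<close>, so exchanging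
  \<open>z\<close> and \<open>y'\<close> leaves \<open>x'\<close> alone. Such maps make two partial
  colourings agree at two shared vertices.\<close>

lemma ex_inj_map2:
  assumes "x \<noteq> y" "x' \<noteq> y'"
  shows "\<exists>\<sigma> :: 'b \<Rightarrow> 'b. inj \<sigma> \<and> \<sigma> x = x' \<and> \<sigma> y = y'"
proof -
  define z where "z = transpose x x' y"
  let ?s = "transpose z y' \<circ> transpose x x'"
  have "z \<noteq> x'" unfolding z_def using assms(1) by (metis transpose_apply_first transpose_involutory)
  then have "?s x = x'" using assms(2) by (simp add: transpose_def)
  moreover have "?s y = y'" by (simp add: z_def)
  moreover have "inj ?s" by (intro inj_compose) auto
  ultimately show ?thesis by blast
qed

section \<open>Proper colourings and their extension\<close>

definition nbrs :: "'a set \<Rightarrow> ('a \<Rightarrow> 'a \<Rightarrow> bool) \<Rightarrow> 'a \<Rightarrow> 'a set" where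
  "nbrs V E v = {u \<in> V. E v u}"

definition proper_colouring :: "'a set \<Rightarrow> ('a \<Rightarrow> 'a \<Rightarrow> bool) \<Rightarrow> ('a \<Rightarrow> 'b) \<Rightarrow> bool" where
  "proper_colouring V E c \<longleftrightarrow> (\<forall>u\<in>V. \<forall>v\<in>V. E u v \<longrightarrow> c u \<noteq> c v)"

text \<open>For an irreflexive \<open>E\<close> the four vertices are automatically
  distinct.\<close>

definition is_K4 :: "('a \<Rightarrow> 'a \<Rightarrow> bool) \<Rightarrow> 'a \<Rightarrow> 'a \<Rightarrow> 'a \<Rightarrow> 'a \<Rightarrow> bool" where
  "is_K4 E a b c d \<longleftrightarrow> E a b \<and> E a c \<and> E a d \<and> E b c \<and> E b d \<and> E c d"

lemma nbrs_mono: "U \<subseteq> V \<Longrightarrow> nbrs U E v \<subseteq> nbrs V E v"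
  by (auto simp: nbrs_def)

lemma finite_nbrs [simp]: "finite V \<Longrightarrow> finite (nbrs V E v)"
  by (simp add: nbrs_def)

lemma proper_colouring_fun_upd:
  assumes "symp E" "irreflp E" "proper_colouring (V - {x}) E c" "k \<notin> c ` nbrs V E x"
  shows "proper_colouring V E (c(x := k))"
  unfolding proper_colouring_def
proof (intro ballI impI)
  fix u v assume uv: "u \<in> V" "v \<in> V" "E u v"
  then have "E v u" "u \<noteq> v" using assms(1,2) by (auto dest: sympD irreflpD)
  with uv show "(c(x := k)) u \<noteq> (c(x := k)) v"
    using assms(3,4) by (auto simp: proper_colouring_def nbrs_def)
qed

text \<open>Greedy colouring: the vertex \<open>x\<close> that the last hypothesis gives for the
  whole of \<open>T\<close> is coloured last, when at most two colours are blocked.\<close>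

lemma proper_colouring_extend:
  fixes c :: "'a \<Rightarrow> colour"
  assumes "symp E" "irreflp E" "finite P" "finite T" "P \<inter> T = {}" "proper_colouring P E c"
    and "\<And>S. S \<subseteq> T \<Longrightarrow> S \<noteq> {} \<Longrightarrow> \<exists>x\<in>S. card (nbrs (P \<union> S) E x) \<le> 2"
  shows "\<exists>c'. proper_colouring (P \<union> T) E c' \<and> (\<forall>v\<in>P. c' v = c v)"
  using assms(4,5,7)
proof (induction T rule: finite_psubset_induct)
  case (psubset T)
  show ?case
  proof (cases "T = {}")
    case True
    then show ?thesis using assms(6) by auto
  next
    case False
    then obtain x where x: "x \<in> T" "card (nbrs (P \<union> T) E x) \<le> 2"
      using psubset.prems(2) by blast
    have "\<exists>c'. proper_colouring (P \<union> (T - {x})) E c' \<and> (\<forall>v\<in>P. c' v = c v)"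
      using x(1) psubset.prems by (intro psubset.IH) auto
    then obtain c' where c': "proper_colouring (P \<union> (T - {x})) E c'" "\<forall>v\<in>P. c' v = c v"
      by blast
    have "card (c' ` nbrs (P \<union> T) E x) \<le> 2"
      using x(2) card_image_le[of "nbrs (P \<union> T) E x" c'] assms(3) psubset.hyps by force
    then obtain k where k: "k \<notin> c' ` nbrs (P \<union> T) E x" using ex_colour_notin by blast
    have "P \<union> (T - {x}) = P \<union> T - {x}" using x(1) psubset.prems(1) by auto
    then have "proper_colouring (P \<union> T) E (c'(x := k))"
      using proper_colouring_fun_upd[OF assms(1,2)] c'(1) k by metis
    moreover have "\<forall>v\<in>P. (c'(x := k)) v = c v" using c'(2) x(1) psubset.prems(1) by auto
    ultimately show ?thesis by blast
  qed
qed

lemma proper_colouring_merge: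
  assumes "symp E" "proper_colouring V\<^sub>1 E c\<^sub>1" "proper_colouring V\<^sub>2 E c\<^sub>2"
    and "\<And>v. v \<in> V\<^sub>1 \<inter> V\<^sub>2 \<Longrightarrow> c\<^sub>1 v = c\<^sub>2 v"
    and "\<And>u v. u \<in> V\<^sub>1 - V\<^sub>2 \<Longrightarrow> v \<in> V\<^sub>2 - V\<^sub>1 \<Longrightarrow> \<not> E u v"
  shows "proper_colouring (V\<^sub>1 \<union> V\<^sub>2) E (\<lambda>v. if v \<in> V\<^sub>1 then c\<^sub>1 v else c\<^sub>2 v)"
  unfolding proper_colouring_def
proof (intro ballI impI)
  fix u v assume uv: "u \<in> V\<^sub>1 \<union> V\<^sub>2" "v \<in> V\<^sub>1 \<union> V\<^sub>2" "E u v"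
  then have vu: "E v u" using assms(1) by (auto dest: sympD)
  have "(u \<in> V\<^sub>1 \<and> v \<in> V\<^sub>1) \<or> (u \<in> V\<^sub>2 \<and> v \<in> V\<^sub>2)" using uv vu assms(5) by blast
  then show "(if u \<in> V\<^sub>1 then c\<^sub>1 u else c\<^sub>2 u) \<noteq> (if v \<in> V\<^sub>1 then c\<^sub>1 v else c\<^sub>2 v)"
    using uv assms(2-4) by (auto simp: proper_colouring_def)
qed

lemma proper_colouring_inj:
  "proper_colouring V E c \<Longrightarrow> inj \<sigma> \<Longrightarrow> proper_colouring V E (\<lambda>v. \<sigma> (c v))"
  by (auto simp: proper_colouring_def inj_eq)

text \<open>The adjacent vertices \<open>z\<close> and \<open>w\<close> have all their neighbours in
  the diamond, and each of \<open>x\<close>, \<open>y\<close> has at most one neighbour outside it.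
  Hence some colour \<open>t\<close> is free for both \<open>x\<close> and \<open>y\<close>, and the
  other two colours serve \<open>z\<close> and \<open>w\<close>.\<close>

lemma brooks_diamond:
  fixes c :: "'a \<Rightarrow> colour"
  assumes E: "symp E" "irreflp E" and V: "finite V" "\<And>v. v \<in> V \<Longrightarrow> card (nbrs V E v) \<le> 3"
    and K4: "\<not> E x y"
    and D: "x \<in> V" "y \<in> V" "z \<in> V" "w \<in> V" "x \<noteq> y" "E z w" "E x z" "E x w" "E y z" "E y w"
    and c: "proper_colouring (V - {x, y, z, w}) E c"
  shows "\<exists>c :: 'a \<Rightarrow> colour. proper_colouring V E c"
proof -
  let ?W = "V - {x, y, z, w}"
  have Esym: "E u v \<Longrightarrow> E v u" for u v using E(1) by (auto dest: sympD)
  have irr: "\<not> E v v" for v using E(2) by (auto dest: irreflpD)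
  have ne: "x \<noteq> z" "x \<noteq> w" "y \<noteq> z" "y \<noteq> w" "z \<noteq> w" using D irr by metis+
  have one: "card (nbrs ?W E v) \<le> 1" if "v \<in> V" "E v z" "E v w" for v
  proof -
    have "nbrs ?W E v \<subseteq> nbrs V E v - {z, w}" by (auto simp: nbrs_def)
    then have "card (nbrs ?W E v) \<le> card (nbrs V E v - {z, w})"
      using V(1) by (intro card_mono) auto
    also have "\<dots> = card (nbrs V E v) - 2"
      using that D(3,4) ne by (subst card_Diff_subset) (auto simp: nbrs_def)
    finally show ?thesis using V(2)[OF that(1)] by linarith
  qed
  have none: "nbrs ?W E v = {}" if v: "v \<in> {z, w}" for v
  proof -
    have "v \<in> V" using that D by auto
    obtain v' where v': "v' \<in> V" "E v v'" "v' \<in> {z, w}"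
      using v D(3,4,6) Esym by (cases "v = z") auto
    have "{x, y, v'} = nbrs V E v"
      using V(2)[OF \<open>v \<in> V\<close>] V(1) that D Esym v' ne
      by (intro card_seteq) (auto simp: nbrs_def)
    then show ?thesis using v' by (auto simp: nbrs_def)
  qed
  have "card (c ` (nbrs ?W E x \<union> nbrs ?W E y)) \<le> card (nbrs ?W E x \<union> nbrs ?W E y)"
    using V(1) by (intro card_image_le) auto
  also have "\<dots> \<le> card (nbrs ?W E x) + card (nbrs ?W E y)" by (rule card_Un_le)
  also have "\<dots> \<le> 2" using one[of x] one[of y] D by linarith
  finally obtain t where t: "t \<notin> c ` (nbrs ?W E x \<union> nbrs ?W E y)" using ex_colour_notin by blast
  obtain k l where kl: "k \<noteq> t" "l \<noteq> t" "k \<noteq> l" using ex_three_colours by blast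
  have *: "proper_colouring (insert v U) E (d(v := i))"
    if "proper_colouring U E d" "v \<notin> U" "\<forall>u\<in>U. E v u \<longrightarrow> d u \<noteq> i" for U d v and i :: colour
    using that irr by (intro proper_colouring_fun_upd[OF E]) (auto simp: nbrs_def)
  have "proper_colouring (insert x ?W) E (c(x := t))"
    using c t by - (rule *, auto simp: nbrs_def)
  moreover have "\<forall>u\<in>insert x ?W. E y u \<longrightarrow> (c(x := t)) u \<noteq> t"
    using t K4 Esym by (auto simp: nbrs_def)
  ultimately have "proper_colouring (insert y (insert x ?W)) E (c(x := t, y := t))"
    using D(5) by - (rule *, auto)
  moreover have "\<forall>u\<in>insert y (insert x ?W). E z u \<longrightarrow> (c(x := t, y := t)) u \<noteq> k"
    using kl none[of z] by (auto simp: nbrs_def)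
  ultimately have "proper_colouring (insert z (insert y (insert x ?W))) E (c(x := t, y := t, z := k))"
    using ne by - (rule *, auto)
  moreover have "\<forall>u\<in>insert z (insert y (insert x ?W)). E w u \<longrightarrow> (c(x := t, y := t, z := k)) u \<noteq> l"
    using kl none[of w] ne by (auto simp: nbrs_def)
  ultimately have "proper_colouring (insert w (insert z (insert y (insert x ?W)))) E (c(x := t, y := t, z := k, w := l))"
    using ne by - (rule *, auto)
  moreover have "insert w (insert z (insert y (insert x ?W))) = V" using D by auto
  ultimately have "proper_colouring V E (c(x := t, y := t, z := k, w := l))" by metis
  then show ?thesis by blast
qed


section \<open>Diamonds and the effect of an added edge\<close>

definition add_edge :: "('a \<Rightarrow> 'a \<Rightarrow> bool) \<Rightarrow> 'a \<Rightarrow> 'a \<Rightarrow> 'a \<Rightarrow> 'a \<Rightarrow> bool" where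
  "add_edge E x y u v \<longleftrightarrow> E u v \<or> (u = x \<and> v = y) \<or> (u = y \<and> v = x)"

lemma symp_add_edge: "symp E \<Longrightarrow> symp (add_edge E x y)"
  by (auto simp: symp_def add_edge_def)

lemma irreflp_add_edge: "irreflp E \<Longrightarrow> x \<noteq> y \<Longrightarrow> irreflp (add_edge E x y)"
  by (auto simp: irreflp_def add_edge_def)

text \<open>The vertices \<open>x\<close> and \<open>y\<close> may be adjacent, so a K4 of an
  irreflexive relation violates this as well.\<close>

definition diamond_free :: "'a set \<Rightarrow> ('a \<Rightarrow> 'a \<Rightarrow> bool) \<Rightarrow> bool" where
  "diamond_free V E \<longleftrightarrow> (\<forall>x\<in>V. \<forall>y\<in>V. \<forall>z\<in>V. \<forall>w\<in>V.
     x \<noteq> y \<longrightarrow> \<not> (E z w \<and> E x z \<and> E x w \<and> E y z \<and> E y w))"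

text \<open>At most one edge of a K4 of the enlarged relation is new, and a K4 that lacks one edge
  is still a diamond.\<close>

lemma no_K4_add_edge:
  assumes E: "symp E" "irreflp E" and xy: "x \<noteq> y"
    and df: "diamond_free V E"
    and V: "a \<in> V" "b \<in> V" "c \<in> V" "d \<in> V"
  shows "\<not> is_K4 (add_edge E x y) a b c d"
proof
  assume K: "is_K4 (add_edge E x y) a b c d"
  have sym: "E u v \<Longrightarrow> E v u" for u v using E(1) by (auto dest: sympD)
  have nd: "\<lbrakk>x \<in> V; y \<in> V; z \<in> V; w \<in> V; x \<noteq> y; E z w; E x z; E x w; E y z; E y w\<rbrakk> \<Longrightarrow> False" for x y z w
    using df unfolding diamond_free_def by blast
  have ne: "a \<noteq> b" "a \<noteq> c" "a \<noteq> d" "b \<noteq> c" "b \<noteq> d" "c \<noteq> d"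
    using K irreflp_add_edge[OF E(2) xy] by (auto simp: is_K4_def dest: irreflpD)
  have K': "add_edge E x y a b" "add_edge E x y a c" "add_edge E x y a d"
    "add_edge E x y b c" "add_edge E x y b d" "add_edge E x y c d"
    using K by (simp_all add: is_K4_def)
  \<comment> \<open>A pair \<open>{s, t}\<close> missing in \<open>E\<close> must be the new edge,
    so all other pairs of the K4 come from \<open>E\<close>.\<close>
  have e: "E u v" if "\<not> E s t" "add_edge E x y s t" "add_edge E x y u v" "{s, t} \<noteq> {u, v}" for s t u v
    using that by (auto simp: add_edge_def)
  show False
  proof (cases "E a b \<and> E a c \<and> E a d")
    case False
    then consider "\<not> E a b" | "\<not> E a c" | "\<not> E a d" by blast
    then show False
    proof cases
      case 1
      then have "E a c" "E a d" "E b c" "E b d" "E c d"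
        using e[OF 1 K'(1)] K' ne by (auto simp: doubleton_eq_iff)
      then show ?thesis using nd V ne by blast
    next
      case 2
      then have "E a b" "E a d" "E c b" "E c d" "E b d"
        using e[OF 2 K'(2)] K' ne sym by (auto simp: doubleton_eq_iff)
      then show ?thesis using nd V ne by blast
    next
      case 3
      then have "E a b" "E a c" "E d b" "E d c" "E b c"
        using e[OF 3 K'(3)] K' ne sym by (auto simp: doubleton_eq_iff)
      then show ?thesis using nd V ne by blast
    qed
  next
    case True
    have "E b c \<and> E b d \<or> E b c \<and> E c d \<or> E b d \<and> E c d"
      using e[OF _ K'(4) K'(5)] e[OF _ K'(4) K'(6)] e[OF _ K'(5) K'(6)] ne
      by (auto simp: doubleton_eq_iff)
    then show ?thesis
      using True nd[of c d a b] nd[of b d a c] nd[of b c a d] V ne sym by blast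
  qed
qed

text \<open>The new neighbour \<open>y\<close> takes the place of \<open>s\<close>, which is lost in
  passing to \<open>U\<close>. The second form serves the other end of the same new edge.\<close>

lemma card_nbrs_add_edge:
  assumes "finite V" "card (nbrs V E x) \<le> 3" "U \<subseteq> V" "s \<in> V - U" "E x s" "\<not> E x x"
  shows "card (nbrs U (add_edge E x y) x) \<le> 3" "card (nbrs U (add_edge E y x) x) \<le> 3"
proof -
  have "nbrs U (add_edge E x y) x \<subseteq> insert y (nbrs V E x - {s})"
       "nbrs U (add_edge E y x) x \<subseteq> insert y (nbrs V E x - {s})"
    using assms by (auto simp: nbrs_def add_edge_def)
  moreover have "card (insert y (nbrs V E x - {s})) \<le> 3"
  proof -
    have "card (nbrs V E x - {s}) = card (nbrs V E x) - 1" "card (nbrs V E x) > 0"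
      using assms by (auto simp: nbrs_def card_gt_0_iff)
    then show ?thesis using assms(1,2) by (auto simp: card_insert_if)
  qed
  ultimately show "card (nbrs U (add_edge E x y) x) \<le> 3" "card (nbrs U (add_edge E y x) x) \<le> 3"
    using assms(1) by (meson card_mono finite_Diff finite_insert finite_nbrs le_trans)+
qed

text \<open>Vertices of degree at most two are coloured last and diamonds are handled by
  \<open>brooks_diamond\<close>; a cubic graph without diamonds remains. Excluding diamonds, and not
  just K4s, keeps the induction hypothesis applicable after an edge is added.\<close>

theorem brooks_subcubic:
  fixes E :: "'a \<Rightarrow> 'a \<Rightarrow> bool"
  assumes "finite V" "symp E" "irreflp E" "\<And>v. v \<in> V \<Longrightarrow> card (nbrs V E v) \<le> 3"
    and "\<And>a b c d. \<lbrakk>a \<in> V; b \<in> V; c \<in> V; d \<in> V\<rbrakk> \<Longrightarrow> \<not> is_K4 E a b c d"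
  shows "\<exists>c :: 'a \<Rightarrow> colour. proper_colouring V E c"
  using assms
proof (induction "card V" arbitrary: V E rule: less_induct)
  case less
  note V = less.prems(1,4) and K4 = less.prems(5)
  have sym: "E u v \<Longrightarrow> E v u" for u v using less.prems(2) by (auto dest: sympD)
  have irr: "\<not> E v v" for v using less.prems(3) by (auto dest: irreflpD)
  have IH: "\<exists>c :: 'a \<Rightarrow> colour. proper_colouring U E c" if "U \<subset> V" for U
  proof (rule less.hyps)
    show "card U < card V" using that V(1) by (simp add: psubset_card_mono)
    show "finite U" using that V(1) finite_subset by blast
    show "card (nbrs U E v) \<le> 3" if "v \<in> U" for v
      using V that \<open>U \<subset> V\<close> nbrs_mono[of U V E v]
      by (meson card_mono finite_nbrs le_trans psubset_imp_subset subsetD)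
  qed (use less.prems that in blast)+
  show ?case
  proof (cases "\<exists>v\<in>V. card (nbrs V E v) \<le> 2")
    case True
    then obtain v where v: "v \<in> V" "card (nbrs V E v) \<le> 2" by blast
    then obtain c :: "'a \<Rightarrow> colour" where c: "proper_colouring (V - {v}) E c" using IH[of "V - {v}"] by blast
    have "card (c ` nbrs V E v) \<le> 2" using v(2) V(1) by (meson card_image_le finite_nbrs le_trans)
    then obtain k where "k \<notin> c ` nbrs V E v" using ex_colour_notin by blast
    then show ?thesis using proper_colouring_fun_upd[OF less.prems(2,3) c] by blast
  next
    case False
    have deg: "card (nbrs V E v) = 3" if "v \<in> V" for v
    proof -
      have "\<not> card (nbrs V E v) \<le> 2" using False that by blast
      then show ?thesis using V(2)[OF that] by linarith
    qed
    show ?thesis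
    proof (cases "diamond_free V E")
      case False
      then obtain x y z w where D: "x \<in> V" "y \<in> V" "z \<in> V" "w \<in> V" "x \<noteq> y" "E z w" "E x z" "E x w" "E y z" "E y w"
        unfolding diamond_free_def by blast
      have "\<not> E x y" using K4[OF D(1-4)] D by (auto simp: is_K4_def)
      moreover obtain c :: "'a \<Rightarrow> colour" where "proper_colouring (V - {x, y, z, w}) E c"
        using IH[of "V - {x, y, z, w}"] D(1) by blast
      ultimately show ?thesis
        using brooks_diamond[OF less.prems(2,3) V] D by blast
    next
      case df: True
      show ?thesis
      proof (cases "V = {}")
        case True
        then show ?thesis unfolding proper_colouring_def by blast
      next
        case False
        then obtain r where r: "r \<in> V" by blast
        obtain a b c where abc: "nbrs V E r = {a, b, c}" "a \<noteq> b" "a \<noteq> c" "b \<noteq> c"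
          using deg[OF r] by (auto simp: card_Suc_eq numeral_3_eq_3)
        have abcV: "a \<in> V" "b \<in> V" "c \<in> V" "E r a" "E r b" "E r c"
          using abc(1) by (auto simp: nbrs_def)
        \<comment> \<open>Otherwise \<open>b\<close> and \<open>c\<close> would be two common
          neighbours of the adjacent vertices \<open>r\<close> and \<open>a\<close>.\<close>
        have "\<not> E a b \<or> \<not> E a c"
          using df abc(4) abcV r sym unfolding diamond_free_def by blast
        then obtain x y z where xyz: "nbrs V E r = {x, y, z}" "x \<noteq> y" "\<not> E x y"
          using abc by (metis insert_commute)
        then have xyV: "x \<in> V" "y \<in> V" "E r x" "E r y" by (auto simp: nbrs_def)
        then have rxy: "r \<noteq> x" "r \<noteq> y" using irr by auto
        (* Give x and y the same colour. If V - {x, y} is connected, it can be coloured greedily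
           towards r; otherwise {x, y} separates a set T, and both sides are coloured by induction
           with the edge xy added, which creates no K4 because there is no diamond. *)
        show ?thesis
        proof (cases "\<exists>T. T \<noteq> {} \<and> T \<subseteq> V - {x, y, r} \<and> (\<forall>u\<in>T. \<forall>v\<in>V - {x, y} - T. \<not> E u v)")
          case False
          let ?T = "V - {x, y, r}"
          \<comment> \<open>As \<open>S\<close> avoids \<open>r\<close> and does not separate, an
            edge \<open>uv\<close> leaves it within \<open>V - {x, y}\<close>; so \<open>u\<close>
            has lost one of its three neighbours.\<close>
          have "\<exists>u\<in>S. card (nbrs ({x, y} \<union> S) E u) \<le> 2" if S: "S \<subseteq> ?T" "S \<noteq> {}" for S
          proof -
            obtain u v where uv: "u \<in> S" "v \<in> V - {x, y} - S" "E u v"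
              using spec[OF False[unfolded not_ex], of S] S by blast
            have "nbrs ({x, y} \<union> S) E u \<subseteq> nbrs V E u - {v}"
              using S uv xyV by (auto simp: nbrs_def)
            then have "card (nbrs ({x, y} \<union> S) E u) \<le> card (nbrs V E u - {v})"
              using V(1) by (intro card_mono) auto
            also have "\<dots> = 2" using uv S deg[of u] V(1) by (auto simp: nbrs_def)
            finally show ?thesis using uv(1) by blast
          qed
          moreover have "proper_colouring {x, y} E (\<lambda>_. Red)"
            using xyz(3) irr sym by (auto simp: proper_colouring_def)
          ultimately obtain c' :: "'a \<Rightarrow> colour" where
            c': "proper_colouring ({x, y} \<union> ?T) E c'" "\<forall>v\<in>{x, y}. c' v = Red"
            using proper_colouring_extend[OF less.prems(2,3), of "{x, y}" ?T "\<lambda>_. Red"] V(1) by auto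
          have "{x, y} \<union> ?T = V - {r}" using xyV rxy by auto
          \<comment> \<open>The common colour of \<open>x\<close> and \<open>y\<close> leaves a
            third colour for \<open>r\<close>.\<close>
          moreover have "c' ` nbrs V E r = {Red, c' z}" using xyz(1) c'(2) by auto
          then have "card (c' ` nbrs V E r) \<le> 2" by (simp add: card_insert_if)
          then obtain k where "k \<notin> c' ` nbrs V E r" using ex_colour_notin by blast
          ultimately show ?thesis using proper_colouring_fun_upd[OF less.prems(2,3)] c'(1) by metis
        next
          case True
          then obtain T where T: "T \<noteq> {}" "T \<subseteq> V - {x, y, r}" "\<forall>u\<in>T. \<forall>v\<in>V - {x, y} - T. \<not> E u v"
            by blast
          show ?thesis
          proof (cases "\<exists>u\<in>{x, y}. \<forall>t\<in>T. \<not> E u t")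
            case True
            \<comment> \<open>If one of \<open>x\<close>, \<open>y\<close> has no neighbour in
              \<open>T\<close>, the other one, \<open>w\<close>, separates \<open>T\<close> alone,
              and matching the colours at \<open>w\<close> suffices.\<close>
            then obtain w where w: "w \<in> {x, y}" "\<forall>v\<in>V - {w} - T. \<forall>u\<in>T. \<not> E v u"
              using T(3) sym by blast
            have sub: "V - T \<subset> V" "insert w T \<subset> V" using T(1,2) w(1) xyV(1,2) r rxy by auto
            obtain c\<^sub>1 :: "'a \<Rightarrow> colour" where c1: "proper_colouring (V - T) E c\<^sub>1"
              using IH[OF sub(1)] by blast
            obtain c\<^sub>2 :: "'a \<Rightarrow> colour" where c2: "proper_colouring (insert w T) E c\<^sub>2"
              using IH[OF sub(2)] by blast
            obtain \<sigma> where \<sigma>: "inj \<sigma>" "\<sigma> (c\<^sub>2 w) = c\<^sub>1 w" using ex_inj_map1[of "c\<^sub>2 w" "c\<^sub>1 w"] by blast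
            have "proper_colouring ((V - T) \<union> insert w T) E (\<lambda>v. if v \<in> V - T then c\<^sub>1 v else \<sigma> (c\<^sub>2 v))"
              using \<sigma> w T(2) xyV
              by (intro proper_colouring_merge[OF less.prems(2) c1 proper_colouring_inj[OF c2 \<sigma>(1)]]) auto
            moreover have "(V - T) \<union> insert w T = V" using T(2) w(1) xyV by auto
            ultimately show ?thesis by metis
          next
            case False
            then obtain s t where st: "s \<in> T" "E x s" "t \<in> T" "E y t" by blast
            let ?E = "add_edge E x y"
            have col: "\<exists>c :: 'a \<Rightarrow> colour. proper_colouring U ?E c"
              if U: "U \<subset> V" and su: "\<exists>s\<in>V - U. E x s" "\<exists>s\<in>V - U. E y s" for U
            proof (rule less.hyps)
              show "card U < card V" using U V(1) by (simp add: psubset_card_mono)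
              show "finite U" using U V(1) finite_subset by blast
              show "symp ?E" "irreflp ?E" using less.prems xyz by (auto intro: symp_add_edge irreflp_add_edge)
              show "card (nbrs U ?E v) \<le> 3" if "v \<in> U" for v
              proof (cases "v \<in> {x, y}")
                case True
                then show ?thesis
                  using su U V xyV(1,2) irr card_nbrs_add_edge[OF V(1) V(2)] by auto
              next
                case False
                then have "nbrs U ?E v \<subseteq> nbrs V E v" using U by (auto simp: nbrs_def add_edge_def)
                then show ?thesis
                  using V that U by (meson card_mono finite_nbrs le_trans psubset_imp_subset subsetD)
              qed
              show "\<not> is_K4 ?E a b c d" if "a \<in> U" "b \<in> U" "c \<in> U" "d \<in> U" for a b c d
              proof -
                have "a \<in> V" "b \<in> V" "c \<in> V" "d \<in> V" using that U by auto
                then show ?thesis using no_K4_add_edge[OF less.prems(2,3) xyz(2) df] by blast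
              qed
            qed
            obtain c\<^sub>1 :: "'a \<Rightarrow> colour" where c1: "proper_colouring (V - T) ?E c\<^sub>1"
              using col[of "V - T"] T(1,2) st by blast
            \<comment> \<open>Here the common neighbour \<open>r\<close> of \<open>x\<close> and
              \<open>y\<close> lies outside the vertex set and makes room for the new edge; for
              \<open>V - T\<close> this was done by \<open>s\<close> and \<open>t\<close>.\<close>
            obtain c\<^sub>2 :: "'a \<Rightarrow> colour" where c2: "proper_colouring (T \<union> {x, y}) ?E c\<^sub>2"
              using col[of "T \<union> {x, y}"] T(2) xyV r rxy sym by blast
            \<comment> \<open>The added edge forces different colours on \<open>x\<close> and
              \<open>y\<close> on both sides, so one permutation matches both vertices.\<close>
            have "c\<^sub>1 x \<noteq> c\<^sub>1 y" "c\<^sub>2 x \<noteq> c\<^sub>2 y"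
              using c1 c2 xyV T(2) by (auto simp: proper_colouring_def add_edge_def)
            then obtain \<sigma> where \<sigma>: "inj \<sigma>" "\<sigma> (c\<^sub>2 x) = c\<^sub>1 x" "\<sigma> (c\<^sub>2 y) = c\<^sub>1 y"
              using ex_inj_map2[of "c\<^sub>2 x" "c\<^sub>2 y" "c\<^sub>1 x" "c\<^sub>1 y"] by blast
            have T': "\<forall>v\<in>V - {x, y} - T. \<forall>u\<in>T. \<not> E v u" using T(3) sym by blast
            have c: "proper_colouring (V - T) E c\<^sub>1" "proper_colouring (T \<union> {x, y}) E c\<^sub>2"
              using c1 c2 by (auto simp: proper_colouring_def add_edge_def)
            have "proper_colouring ((V - T) \<union> (T \<union> {x, y})) E (\<lambda>v. if v \<in> V - T then c\<^sub>1 v else \<sigma> (c\<^sub>2 v))"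
              using \<sigma> T(2) T' xyV
              by (intro proper_colouring_merge[OF less.prems(2) c(1) proper_colouring_inj[OF c(2) \<sigma>(1)]]) auto
            moreover have "(V - T) \<union> (T \<union> {x, y}) = V" using T(2) xyV by auto
            ultimately show ?thesis by metis
          qed
        qed
      qed
    qed
  qed
qed

section \<open>Tutte's theorem\<close>

definition perfect_matching :: "'a set \<Rightarrow> ('a \<Rightarrow> 'a \<Rightarrow> bool) \<Rightarrow> ('a \<Rightarrow> 'a) \<Rightarrow> bool" where
  "perfect_matching U R m \<longleftrightarrow> (\<forall>u. m (m u) = u) \<and> (\<forall>u\<in>U. m u \<in> U \<and> R u (m u))"

text \<open>The fibres of a labelling \<open>f\<close> that is constant along edges are unions of
  components, so they can stand in for the components in Tutte's condition.\<close>

definition odd_classes :: "'a set \<Rightarrow> ('a \<Rightarrow> 'b) \<Rightarrow> 'b set" where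
  "odd_classes W f = {k. odd (card {u \<in> W. f u = k})}"

lemma odd_classes_subset: "odd_classes W f \<subseteq> f ` W"
proof
  fix k assume "k \<in> odd_classes W f"
  then have "{u \<in> W. f u = k} \<noteq> {}" unfolding odd_classes_def by force
  then show "k \<in> f ` W" by auto
qed

lemma finite_odd_classes: "finite W \<Longrightarrow> finite (odd_classes W f)"
  by (rule finite_subset[OF odd_classes_subset finite_imageI])

text \<open>The fibres partition \<open>W\<close>, and modulo two only those of odd size
  count.\<close>

lemma even_card_odd_classes:
  assumes "finite W"
  shows "even (card (odd_classes W f)) \<longleftrightarrow> even (card W)"
proof -
  have "card W = (\<Sum>k\<in>f ` W. card {u \<in> W. f u = k})"
    using card_eq_sum sum.image_gen[OF assms, of "\<lambda>_. 1 :: nat" f] by simp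
  then have "even (card W) \<longleftrightarrow> even (card {k \<in> f ` W. odd (card {u \<in> W. f u = k})})"
    using assms by (simp add: even_sum_iff)
  also have "{k \<in> f ` W. odd (card {u \<in> W. f u = k})} = odd_classes W f"
    using odd_classes_subset[of W f] by (auto simp: odd_classes_def)
  finally show ?thesis by simp
qed

lemma odd_classes_remove_pair:
  assumes "finite W" "x \<in> W" "y \<in> W" "x \<noteq> y" "f x = f y"
  shows "odd_classes (W - {x, y}) f = odd_classes W f"
proof -
  have "odd (card {u \<in> W - {x, y}. f u = k}) \<longleftrightarrow> odd (card {u \<in> W. f u = k})" for k
  proof (cases "f x = k")
    case True
    then have "{u \<in> W. f u = k} = insert x (insert y {u \<in> W - {x, y}. f u = k})" using assms by auto
    then have "card {u \<in> W. f u = k} = Suc (Suc (card {u \<in> W - {x, y}. f u = k}))"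
      using assms by simp
    then show ?thesis by simp
  next
    case False
    then have "{u \<in> W - {x, y}. f u = k} = {u \<in> W. f u = k}" using assms by auto
    then show ?thesis by simp
  qed
  then show ?thesis by (simp add: odd_classes_def)
qed

section \<open>Tutte's condition when the classes outside \<open>S\<close> are cliques\<close>

lemma perfect_matching_insert_pair:
  assumes "perfect_matching (U - {x, y}) R m" "x \<in> U" "y \<in> U" "x \<noteq> y" "R x y" "R y x"
  shows "\<exists>m. perfect_matching U R m"
proof
  let ?m = "\<lambda>u. if u = x then y else if u = y then x else if u \<in> U then m u else u"
  have "m u \<in> U \<and> m u \<noteq> x \<and> m u \<noteq> y \<and> R u (m u) \<and> m (m u) = u" if "u \<in> U" "u \<noteq> x" "u \<noteq> y" for u
    using assms(1) that by (auto simp: perfect_matching_def)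
  then show "perfect_matching U R ?m"
    using assms(2-6) by (auto simp: perfect_matching_def)
qed

text \<open>Pairs are split off: first two vertices of one class, which keeps the odd classes; once
  each class is a single vertex, and hence odd, such a vertex with an element of \<open>S\<close>;
  finally two elements of \<open>S\<close>. Evenness of \<open>card U\<close> provides the partner
  in the last case.\<close>

lemma ex_perfect_matching_cliques:
  fixes f :: "'a \<Rightarrow> 'b"
  assumes "finite U" "even (card U)" "S \<subseteq> U" "card (odd_classes (U - S) f) \<le> card S" "symp R"
    and "\<And>s u. s \<in> S \<Longrightarrow> u \<in> U \<Longrightarrow> s \<noteq> u \<Longrightarrow> R s u"
    and "\<And>u v. u \<in> U - S \<Longrightarrow> v \<in> U - S \<Longrightarrow> u \<noteq> v \<Longrightarrow> f u = f v \<Longrightarrow> R u v"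
  shows "\<exists>m. perfect_matching U R m"
  using assms(1-4,6,7)
proof (induction "card U" arbitrary: U S rule: less_induct)
  case less
  have sym: "R u v \<Longrightarrow> R v u" for u v using assms(5) by (auto dest: sympD)
  have step: ?case
    if xy: "x \<in> U" "y \<in> U" "x \<noteq> y" "R x y"
      and oc: "card (odd_classes (U - {x, y} - (S - {x, y})) f) \<le> card (S - {x, y})" for x y
  proof -
    have cU: "card (U - {x, y}) = card U - 2" "card U \<ge> 2"
      using xy less.prems(1) card_mono[of U "{x, y}"] by (auto simp: card_Diff_subset)
    have "\<exists>m. perfect_matching (U - {x, y}) R m"
    proof (rule less.hyps[of _ "S - {x, y}"])
      show "card (U - {x, y}) < card U" "even (card (U - {x, y}))" using cU less.prems(2) by auto
      show "finite (U - {x, y})" "S - {x, y} \<subseteq> U - {x, y}" using less.prems(1,3) by auto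
      show "R s u" if "s \<in> S - {x, y}" "u \<in> U - {x, y}" "s \<noteq> u" for s u
        using that by (intro less.prems(5)) auto
      show "R u v" if "u \<in> U - {x, y} - (S - {x, y})" "v \<in> U - {x, y} - (S - {x, y})" "u \<noteq> v" "f u = f v"
        for u v using that by (intro less.prems(6)) auto
    qed (rule oc)
    then show ?thesis using perfect_matching_insert_pair xy sym by metis
  qed
  show ?case
  proof (cases "\<exists>x\<in>U - S. \<exists>y\<in>U - S. x \<noteq> y \<and> f x = f y")
    case True
    then obtain x y where xy: "x \<in> U - S" "y \<in> U - S" "x \<noteq> y" "f x = f y" by blast
    have "U - {x, y} - (S - {x, y}) = (U - S) - {x, y}" "S - {x, y} = S" using xy by auto
    moreover have "odd_classes ((U - S) - {x, y}) f = odd_classes (U - S) f"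
      using xy less.prems(1) by (intro odd_classes_remove_pair) auto
    moreover have "R x y" using xy less.prems(6) by blast
    ultimately show ?thesis using step[of x y] xy less.prems(4) by simp
  next
    case False
    then have inj: "inj_on f (U - S)" by (auto simp: inj_on_def)
    have oc: "odd_classes W f = f ` W" if "W \<subseteq> U - S" for W
    proof
      show "f ` W \<subseteq> odd_classes W f"
      proof
        fix k assume "k \<in> f ` W"
        then obtain u where "u \<in> W" "k = f u" by blast
        then have "{v \<in> W. f v = k} = {u}" using inj that by (auto simp: inj_on_def)
        then show "k \<in> odd_classes W f" by (simp add: odd_classes_def)
      qed
    qed (rule odd_classes_subset)
    have oc_card: "card (odd_classes W f) = card W" if "W \<subseteq> U - S" for W
      using oc[OF that] card_image[OF inj_on_subset[OF inj that]] by simp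
    have fS: "finite S" using less.prems(1,3) finite_subset by blast
    show ?thesis
    proof (cases "U - S = {}")
      case False
      then obtain x where x: "x \<in> U - S" by blast
      have "card (U - S) > 0" using x less.prems(1) card_gt_0_iff by blast
      then have "card S > 0" using less.prems(4) oc_card[of "U - S"] by simp
      then obtain s where s: "s \<in> S" by fastforce
      have "U - {x, s} - (S - {x, s}) = U - S - {x}" "S - {x, s} = S - {s}" using x s by auto
      moreover have "s \<in> U" "x \<noteq> s" using x s less.prems(3) by auto
      moreover from this have "R x s" using x s less.prems(5) sym by auto
      moreover have "card (U - S - {x}) = card (U - S) - 1" "card (S - {s}) = card S - 1"
        using x s less.prems(1) fS by auto
      ultimately show ?thesis
        using step[of x s] \<open>s \<in> U\<close> \<open>x \<noteq> s\<close> \<open>R x s\<close> x less.prems(4) oc_card[of "U - S"]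
          oc_card[of "U - S - {x}"] by (simp add: Diff_subset diff_le_mono)
    next
      case True
      then have SU: "S = U" using less.prems(3) by auto
      show ?thesis
      proof (cases "U = {}")
        case True
        then show ?thesis by (intro exI[of _ id]) (simp add: perfect_matching_def)
      next
        case False
        then obtain x where x: "x \<in> U" by blast
        have "U \<noteq> {x}" using less.prems(2) by auto
        then obtain y where "y \<in> U" "y \<noteq> x" using x by blast
        moreover from this have "R x y" using x SU less.prems(5) by simp
        moreover have "U - {x, y} - (S - {x, y}) = {}" using SU by auto
        then have "card (odd_classes (U - {x, y} - (S - {x, y})) f) \<le> card (S - {x, y})"
          unfolding odd_classes_def by (simp only: empty_iff) simp
        ultimately show ?thesis using step[of x y] x by blast
      qed
    qed
  qed
qed

section \<open>Exchanging two matchings along an alternating path\<close>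

lemma funpow_returns:
  fixes g :: "'a \<Rightarrow> 'a"
  assumes "finite U" "inj g" "\<And>u. u \<in> U \<Longrightarrow> g u \<in> U" "b \<in> U"
  shows "\<exists>n>0. (g ^^ n) b = b"
proof -
  have "(g ^^ n) b \<in> U" for n by (induction n) (use assms in auto)
  then have "finite {y. \<exists>n. y = (g ^^ n) b}" using assms(1) by (auto elim: finite_subset[rotated])
  then show ?thesis using funpow_inj_finite[OF assms(2)] by metis
qed

(* Follow the alternating path b, m1 b, m2 (m1 b), ..., whose even vertices are y 0, y 1, ...
   If it returns to b without meeting a or c, use m1 on its vertices and m2 elsewhere. If it first
   meets {a, c} in y K, use m2 on the path without b, the edge from b to the other vertex z of
   {a, c}, and m1 elsewhere. *)
lemma perfect_matching_exchange:
  assumes U: "finite U" and R: "symp R" "irreflp R"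
    and abcd: "a \<in> U" "b \<in> U" "c \<in> U" "R a b" "R b c" "a \<noteq> c" "b \<noteq> d"
    and m1: "perfect_matching U (\<lambda>u v. R u v \<or> {u, v} = {a, c}) m1"
    and m2: "perfect_matching U (\<lambda>u v. R u v \<or> {u, v} = {b, d}) m2"
    and no: "\<nexists>m. perfect_matching U R m"
  shows False
proof -
  have sym: "R u v \<Longrightarrow> R v u" for u v using R(1) by (auto dest: sympD)
  have irr: "\<not> R v v" for v using R(2) by (auto dest: irreflpD)
  have i1 [simp]: "m1 (m1 u) = u" and i2 [simp]: "m2 (m2 u) = u" for u
    using m1 m2 by (auto simp: perfect_matching_def)
  have U1 [simp]: "u \<in> U \<Longrightarrow> m1 u \<in> U" and U2 [simp]: "u \<in> U \<Longrightarrow> m2 u \<in> U" for u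
    using m1 m2 by (auto simp: perfect_matching_def)
  have R1: "R u (m1 u)" if "u \<in> U" "u \<noteq> a" "u \<noteq> c" for u
    using m1 that by (auto simp: perfect_matching_def doubleton_eq_iff)
  have R2: "R u (m2 u)" if "u \<in> U" "u \<noteq> b" "m2 u \<noteq> b" for u
    using m2 that unfolding perfect_matching_def by (metis doubleton_eq_iff)
  \<comment> \<open>If \<open>m1\<close> did not use the extra pair \<open>{a, c}\<close>, it would
    be a perfect matching for \<open>R\<close> itself. The same holds for \<open>m2\<close> and
    \<open>{b, d}\<close>.\<close>
  have m1a: "m1 a = c"
  proof (rule ccontr)
    assume "m1 a \<noteq> c"
    moreover from this have "m1 c \<noteq> a" by (metis i1)
    ultimately have "perfect_matching U R m1"
      using m1 abcd(6) unfolding perfect_matching_def by (metis doubleton_eq_iff)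
    with no show False by blast
  qed
  then have m1c: "m1 c = a" by (metis i1)
  have bac: "b \<noteq> a" "b \<noteq> c" using abcd irr by auto
  have bd: "m2 b = d"
  proof (rule ccontr)
    assume "m2 b \<noteq> d"
    moreover from this have "m2 d \<noteq> b" by (metis i2)
    ultimately have "perfect_matching U R m2"
      using m2 unfolding perfect_matching_def by (metis doubleton_eq_iff i2)
    with no show False by blast
  qed
  define g where "g = (\<lambda>u. m2 (m1 u))"
  define y where "y = (\<lambda>k. (g ^^ k) b)"
  have y0: "y 0 = b" and ySuc: "y (Suc k) = m2 (m1 (y k))" for k
    by (simp_all add: y_def g_def)
  have inj: "inj g" unfolding g_def by (metis injI i1 i2)
  have yU: "y k \<in> U" for k by (induction k) (use abcd(2) in \<open>auto simp: y0 ySuc\<close>)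
  show False
  proof (cases "\<exists>k. y k \<in> {a, c}")
    case False
    define Q where "Q = range y \<union> range (\<lambda>k. m1 (y k))"
    obtain n where n: "n > 0" "y n = b"
      using funpow_returns[OF U inj, of b] abcd(2) unfolding y_def g_def by auto
    then obtain k where k: "n = Suc k" using gr0_conv_Suc by blast
    have Q1: "m1 u \<in> Q" if "u \<in> Q" for u using that by (auto simp: Q_def)
    \<comment> \<open>Only \<open>y 0 = b\<close> needs the return to \<open>b\<close>: its
      \<open>m2\<close>-partner is \<open>m1 (y k)\<close>, the last vertex before the cycle
      closes.\<close>
    have "m2 (y j) \<in> Q" for j
    proof (cases j)
      case 0
      then have "m2 (y j) = m1 (y k)" using n k ySuc y0 by (metis i2)
      then show ?thesis by (auto simp: Q_def)
    next
      case (Suc i)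
      then show ?thesis by (auto simp: Q_def ySuc)
    qed
    moreover have "m2 (m1 (y j)) \<in> Q" for j using ySuc[of j] by (metis Q_def UnI1 rangeI)
    ultimately have Q2: "m2 u \<in> Q" if "u \<in> Q" for u using that by (auto simp: Q_def)
    have "m1 (y k) \<notin> {a, c}" for k
    proof
      assume "m1 (y k) \<in> {a, c}"
      then have "m1 (m1 (y k)) \<in> {m1 a, m1 c}" by blast
      then have "y k \<in> {c, a}" unfolding i1 m1a m1c .
      then show False using False by blast
    qed
    then have acQ: "a \<notin> Q" "c \<notin> Q" using False by (auto simp: Q_def)
    have bQ: "b \<in> Q" using y0 by (metis Q_def UnI1 rangeI)
    let ?m = "\<lambda>u. if u \<in> Q then m1 u else m2 u"
    have "perfect_matching U R ?m"
      unfolding perfect_matching_def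
    proof (intro conjI allI ballI)
      fix u
      show "?m (?m u) = u" using Q1[of u] Q2[of "m2 u"] by auto
    next
      fix u assume u: "u \<in> U"
      show "?m u \<in> U" using u by auto
      have "m2 u \<noteq> b" if "u \<notin> Q" using that bQ Q2 by (metis i2)
      then show "R u (?m u)" using u R1[of u] R2[of u] acQ bQ by auto
    qed
    with no show False by blast
  next
    case True
    define K where "K = (LEAST k. y k \<in> {a, c})"
    have yK: "y K \<in> {a, c}" unfolding K_def using True by (rule LeastI_ex)
    have min: "y k \<notin> {a, c}" if "k < K" for k using that not_less_Least unfolding K_def by blast
    have K0: "K \<noteq> 0" using yK y0 bac by (metis insertE singletonD)
    define z where "z = m1 (y K)"
    have z: "z \<in> {a, c}" "z \<noteq> y K" "R b z" "z \<in> U"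
      using yK m1a m1c abcd sym by (auto simp: z_def)
    \<comment> \<open>The path from \<open>m1 b\<close> to \<open>y K\<close>, which
      \<open>m2\<close> splits into the pairs of \<open>m1 (y k)\<close> and
      \<open>y (Suc k)\<close>.\<close>
    define P where "P = (\<lambda>k. m1 (y k)) ` {..<K} \<union> (\<lambda>k. y (Suc k)) ` {..<K}"
    have P2: "m2 u \<in> P" if "u \<in> P" for u
      using that unfolding P_def by (auto simp: ySuc)
    have zP: "z \<notin> P"
    proof
      assume "z \<in> P"
      then consider k where "k < K" "z = m1 (y k)" | k where "k < K" "z = y (Suc k)"
        by (auto simp: P_def)
      then show False
      proof cases
        case 1
        then have "y K = y k" unfolding z_def by (metis i1)
        then show False using min[OF 1(1)] yK by simp
      next
        case 2
        then show False using min[of "Suc k"] z(1,2) by (cases "Suc k = K") auto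
      qed
    qed
    have bP: "b \<notin> P"
    proof
      assume "b \<in> P"
      then consider k where "k < K" "b = m1 (y k)" | k where "k < K" "b = y (Suc k)"
        by (auto simp: P_def)
      then show False
      proof cases
        case 2
        \<comment> \<open>A return to \<open>b\<close> makes the sequence periodic, so
          \<open>y K\<close> would occur at an earlier index.\<close>
        have "y (i + Suc k) = y i" for i
          using 2(2) unfolding y_def funpow_add by simp
        from this[of "K - Suc k"] have "y K = y (K - Suc k)" using 2(1) by simp
        then show False using min[of "K - Suc k"] yK K0 by simp
      next
        case 1
        \<comment> \<open>If the path reaches \<open>b\<close> as \<open>m1 (y k)\<close>, it runs
          back over itself. Its middle is then a fixed point of \<open>m1\<close> for even
          \<open>k\<close> and of \<open>m2\<close> for odd \<open>k\<close>.\<close>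
        have pal: "i \<le> k \<Longrightarrow> m1 (y (k - i)) = y i" for i
        proof (induction i)
          case 0
          then show ?case using 1 y0 by simp
        next
          case (Suc i)
          then have "y (k - i) = m2 (m1 (y (k - Suc i)))"
            using ySuc[of "k - Suc i"] by (simp add: Suc_diff_Suc)
          then have "m1 (y (k - Suc i)) = m2 (y (k - i))" by simp
          also have "y (k - i) = m1 (y i)" using Suc by (metis Suc_leD i1)
          finally show ?case using ySuc by simp
        qed
        show False
        proof (cases "even k")
          case True
          then obtain j where j: "k = j + j" by (metis evenE mult_2)
          have "m1 (y j) = y j" using pal[of j] j by simp
          moreover have "y j \<notin> {a, c}" using min[of j] 1(1) j by simp
          ultimately show False using R1[OF yU, of j] irr by force
        next
          case False
          then obtain j where j: "k = Suc (j + j)" by (metis oddE mult_2 Suc_eq_plus1)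
          have "m1 (y (Suc j)) = y j" using pal[of j] j by simp
          then have "y (Suc j) = m1 (y j)" by (metis i1)
          then have e: "m2 (y (Suc j)) = y (Suc j)" using ySuc[of j] by simp
          moreover have "R (y (Suc j)) (m2 (y (Suc j))) \<or> {y (Suc j), m2 (y (Suc j))} = {b, d}"
            using m2 yU by (auto simp: perfect_matching_def)
          ultimately show False using irr abcd(7) by (auto simp: doubleton_eq_iff)
        qed
      qed
    qed
    have yKP: "y K \<in> P" using K0 by (cases K) (auto simp: P_def)
    \<comment> \<open>Together with \<open>b\<close> and \<open>z\<close>, the set \<open>P\<close>
      consists of the \<open>m1\<close>-pairs of \<open>y k\<close> and \<open>m1 (y k)\<close> for
      \<open>k \<le> K\<close>, so \<open>m1\<close> preserves the complement.\<close>
    have P1: "m1 u \<notin> P \<and> m1 u \<noteq> b \<and> m1 u \<noteq> z" if u: "u \<notin> P" "u \<noteq> b" "u \<noteq> z" for u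
    proof (intro conjI notI)
      assume "m1 u = b"
      then have "u = m1 (y 0)" using y0 i1 by metis
      then show False using K0 u(1) by (auto simp: P_def)
    next
      assume "m1 u = z"
      then have "u = y K" unfolding z_def by (metis i1)
      then show False using yKP u(1) by simp
    next
      assume "m1 u \<in> P"
      then consider k where "k < K" "m1 u = m1 (y k)" | k where "k < K" "m1 u = y (Suc k)"
        by (auto simp: P_def)
      then show False
      proof cases
        case 1
        then have "u = y k" by (metis i1)
        then show False using u 1(1) y0 by (cases k) (auto simp: P_def)
      next
        case 2
        then have "u = m1 (y (Suc k))" by (metis i1)
        then show False using u 2(1) by (cases "Suc k = K") (auto simp: P_def z_def)
      qed
    qed
    let ?m = "\<lambda>u. if u \<in> P then m2 u else if u = b then z else if u = z then b else m1 u"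
    have "perfect_matching U R ?m"
      unfolding perfect_matching_def
    proof (intro conjI allI ballI)
      fix u
      show "?m (?m u) = u" using P1[of u] P2[of u] zP bP by auto
    next
      fix u assume u: "u \<in> U"
      show "?m u \<in> U" using u z(4) abcd(2) by auto
      have "m2 u \<noteq> b \<and> u \<noteq> b" if "u \<in> P" using that bP P2 by metis
      moreover have "u \<noteq> a \<and> u \<noteq> c" if "u \<notin> P" "u \<noteq> z" using that z(1,2) yK yKP by auto
      ultimately show "R u (?m u)" using u R1[of u] R2[of u] z(3) sym by auto
    qed
    with no show False by blast
  qed
qed


text \<open>Induction on the number of nonadjacent pairs. If some edge can be added without creating
  a perfect matching, the \<open>S\<close> and \<open>f\<close> of the larger relation also work for
  \<open>R\<close>. Otherwise \<open>S\<close> consists of the vertices adjacent to all others;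
  outside \<open>S\<close> adjacency is transitive by \<open>perfect_matching_exchange\<close>, so
  the classes are cliques and must be too many.\<close>

theorem tutte:
  assumes "finite U" "even (card U)" "symp R" "irreflp R" "\<nexists>m. perfect_matching U R m"
  shows "\<exists>S (f :: 'a \<Rightarrow> 'a set). S \<subseteq> U \<and> card S < card (odd_classes (U - S) f)
           \<and> (\<forall>u\<in>U - S. \<forall>v\<in>U - S. R u v \<longrightarrow> f u = f v)"
  using assms(3-5)
proof (induction "card (U \<times> U - {(u, v). R u v})" arbitrary: R rule: less_induct)
  case less
  have sym: "R u v \<Longrightarrow> R v u" for u v using less.prems(1) by (auto dest: sympD)
  have irr: "\<not> R v v" for v using less.prems(2) by (auto dest: irreflpD)
  let ?R = "\<lambda>a c u v. R u v \<or> {u, v} = {a, c}"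
  show ?case
  proof (cases "\<exists>a\<in>U. \<exists>c\<in>U. a \<noteq> c \<and> \<not> R a c \<and> (\<nexists>m. perfect_matching U (?R a c) m)")
    case True
    then obtain a c where ac: "a \<in> U" "c \<in> U" "a \<noteq> c" "\<not> R a c" "\<nexists>m. perfect_matching U (?R a c) m"
      by blast
    have "U \<times> U - {(u, v). ?R a c u v} \<subset> U \<times> U - {(u, v). R u v}" using ac by auto
    then have "card (U \<times> U - {(u, v). ?R a c u v}) < card (U \<times> U - {(u, v). R u v})"
      using assms(1) by (intro psubset_card_mono) auto
    moreover have "symp (?R a c)" using sym by (auto simp: symp_def insert_commute)
    moreover have "irreflp (?R a c)" using irr ac(3) by (auto simp: irreflp_def)
    ultimately obtain S f where "S \<subseteq> U" "card S < card (odd_classes (U - S) (f :: 'a \<Rightarrow> 'a set))"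
      "\<forall>u\<in>U - S. \<forall>v\<in>U - S. ?R a c u v \<longrightarrow> f u = f v"
      using less.hyps[of "?R a c"] ac(5) by blast
    then show ?thesis by blast
  next
    case False
    then have sat: "\<exists>m. perfect_matching U (?R a c) m" if "a \<in> U" "c \<in> U" "a \<noteq> c" "\<not> R a c" for a c
      using that by blast
    define S where "S = {s \<in> U. \<forall>u\<in>U. s \<noteq> u \<longrightarrow> R s u}"
    \<comment> \<open>As \<open>b\<close> is not in \<open>S\<close>, it has a nonneighbour
      \<open>d\<close>. Adding \<open>ac\<close> or \<open>bd\<close> gives a perfect matching each,
      and these two are exchanged.\<close>
    have trans: "R a c" if abc: "a \<in> U" "b \<in> U - S" "c \<in> U" "R a b" "R b c" "a \<noteq> c" for a b c
    proof (rule ccontr)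
      assume "\<not> R a c"
      then obtain m1 where m1: "perfect_matching U (?R a c) m1" using sat abc by blast
      obtain d where d: "d \<in> U" "b \<noteq> d" "\<not> R b d" using abc(2) by (auto simp: S_def)
      then obtain m2 where m2: "perfect_matching U (?R b d) m2" using sat abc by blast
      show False
        by (rule perfect_matching_exchange[OF assms(1) less.prems(1,2) _ _ _ _ _ _ _ m1 m2 less.prems(3)])
          (use abc d in auto)
    qed
    \<comment> \<open>Each clique outside \<open>S\<close> is labelled by itself, as the closed
      neighbourhood of any of its members.\<close>
    define f where "f = (\<lambda>u. {v \<in> U - S. v = u \<or> R u v})"
    have f_sub: "f u \<subseteq> f v" if uv: "u \<in> U - S" "v \<in> U - S" "R u v" for u v
    proof
      fix x assume "x \<in> f u"
      then have x: "x \<in> U - S" "x = u \<or> R u x" by (auto simp: f_def)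
      have "x = v \<or> R v x" using trans[of v u x] x uv sym[of u v] by auto
      then show "x \<in> f v" using x(1) by (auto simp: f_def)
    qed
    have f_eq: "f u = f v" if "u \<in> U - S" "v \<in> U - S" "R u v" for u v
      using f_sub[of u v] f_sub[of v u] that sym[of u v] by auto
    have f_R: "R u v" if "u \<in> U - S" "v \<in> U - S" "f u = f v" "u \<noteq> v" for u v
    proof -
      have "v \<in> f u" using that(2,3) by (simp add: f_def)
      then show ?thesis using that(4) by (auto simp: f_def)
    qed
    have "\<not> card (odd_classes (U - S) f) \<le> card S"
    proof
      assume le: "card (odd_classes (U - S) f) \<le> card S"
      have "\<exists>m. perfect_matching U R m"
      proof (rule ex_perfect_matching_cliques[OF assms(1,2) _ le less.prems(1)])
        show "S \<subseteq> U" by (auto simp: S_def)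
        show "R s u" if "s \<in> S" "u \<in> U" "s \<noteq> u" for s u using that by (auto simp: S_def)
        show "R u v" if "u \<in> U - S" "v \<in> U - S" "u \<noteq> v" "f u = f v" for u v
          using f_R[OF that(1,2,4,3)] .
      qed
      with less.prems(3) show False by blast
    qed
    then have "card S < card (odd_classes (U - S) f)" by simp
    moreover have "S \<subseteq> U" by (auto simp: S_def)
    moreover have "\<forall>u\<in>U - S. \<forall>v\<in>U - S. R u v \<longrightarrow> f u = f v" using f_eq by simp
    ultimately show ?thesis by blast
  qed
qed

section \<open>Colourings without monochromatic triples in closed neighbourhoods\<close>

definition no_triple :: "('a \<Rightarrow> 'b) \<Rightarrow> 'a set \<Rightarrow> bool" where
  "no_triple c S \<longleftrightarrow> (\<forall>x\<in>S. \<forall>y\<in>S. \<forall>z\<in>S. x \<noteq> y \<longrightarrow> x \<noteq> z \<longrightarrow> y \<noteq> z \<longrightarrow> c x = c y \<longrightarrow> c x \<noteq> c z)"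

definition limited_colouring :: "'a set \<Rightarrow> ('a \<Rightarrow> 'a \<Rightarrow> bool) \<Rightarrow> ('a \<Rightarrow> 'b) \<Rightarrow> bool" where
  "limited_colouring V E c \<longleftrightarrow> (\<forall>v\<in>V. no_triple c (insert v (nbrs V E v)))"

lemma no_triple_insert:
  assumes "no_triple c S" "\<And>x y. x \<in> S \<Longrightarrow> y \<in> S \<Longrightarrow> x \<noteq> y \<Longrightarrow> c x = c y \<Longrightarrow> c w \<noteq> c x"
  shows "no_triple c (insert w S)"
  unfolding no_triple_def
proof (intro ballI impI notI)
  fix x y z
  assume xyz: "x \<in> insert w S" "y \<in> insert w S" "z \<in> insert w S" "x \<noteq> y" "x \<noteq> z" "y \<noteq> z" "c x = c y" "c x = c z"
  consider "x = w" "y \<in> S" "z \<in> S" | "y = w" "x \<in> S" "z \<in> S" | "z = w" "x \<in> S" "y \<in> S"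
    | "x \<in> S" "y \<in> S" "z \<in> S" using xyz by blast
  then show False
  proof cases
    case 1
    then show ?thesis using assms(2)[of y z] xyz by simp
  next
    case 2
    then show ?thesis using assms(2)[of x z] xyz by simp
  next
    case 3
    then show ?thesis using assms(2)[of x y] xyz by simp
  next
    case 4
    then show ?thesis using assms(1) xyz(4-) unfolding no_triple_def by blast
  qed
qed

lemma no_triple_cong:
  assumes "\<And>v. v \<in> S \<Longrightarrow> c v = c' v"
  shows "no_triple c S \<longleftrightarrow> no_triple c' S"
  unfolding no_triple_def using assms by (simp cong: ball_cong)

lemma limited_colouring_inj:
  "limited_colouring V E c \<Longrightarrow> inj \<sigma> \<Longrightarrow> limited_colouring V E (\<lambda>v. \<sigma> (c v))"
  unfolding limited_colouring_def no_triple_def by (simp add: inj_eq)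

lemma limited_colouring_cong:
  assumes "\<And>v. v \<in> V \<Longrightarrow> c v = c' v"
  shows "limited_colouring V E c \<longleftrightarrow> limited_colouring V E c'"
proof -
  have "no_triple c (insert v (nbrs V E v)) \<longleftrightarrow> no_triple c' (insert v (nbrs V E v))" if "v \<in> V" for v
    using that by (intro no_triple_cong assms) (auto simp: nbrs_def)
  then show ?thesis unfolding limited_colouring_def by simp
qed

section \<open>Joining colourings across a cut of at most one edge\<close>

definition one_edge_cut :: "'a set \<Rightarrow> ('a \<Rightarrow> 'a \<Rightarrow> bool) \<Rightarrow> 'a set \<Rightarrow> bool" where
  "one_edge_cut V E Q \<longleftrightarrow> Q \<noteq> {} \<and> Q \<subset> V \<and>
     (\<exists>u\<^sub>0 v\<^sub>0. \<forall>u\<in>Q. \<forall>v\<in>V - Q. E u v \<longrightarrow> u = u\<^sub>0 \<and> v = v\<^sub>0)"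

text \<open>Two different repeated colours would need four vertices. If no colour repeats, any
  \<open>i\<close> will do.\<close>

lemma repeated_colour:
  assumes "finite A" "card A \<le> 3"
  shows "\<exists>i. \<forall>x\<in>A. \<forall>y\<in>A. x \<noteq> y \<longrightarrow> c x = c y \<longrightarrow> c x = i"
proof (cases "\<exists>x\<in>A. \<exists>y\<in>A. x \<noteq> y \<and> c x = c y")
  case True
  then obtain x y where xy: "x \<in> A" "y \<in> A" "x \<noteq> y" "c x = c y" by blast
  have "card (A - {x, y}) = card A - 2" using xy card_Diff_subset[of "{x, y}" A] by simp
  then have "card (A - {x, y}) \<le> Suc 0" using assms(2) by linarith
  then have one: "u = v" if "u \<in> A - {x, y}" "v \<in> A - {x, y}" for u v
    using card_le_Suc0_iff_eq[of "A - {x, y}"] assms(1) that by blast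
  have "c u = c x" if "u \<in> A" "v \<in> A" "u \<noteq> v" "c u = c v" for u v
    using one[of u v] that xy(4) by (cases "u \<in> {x, y}"; cases "v \<in> {x, y}") auto
  then show ?thesis by blast
qed blast

text \<open>Only the closed neighbourhoods of the ends \<open>u\<^sub>0\<close> and
  \<open>v\<^sub>0\<close> of the cut edge change, each by one new vertex. By
  \<open>repeated_colour\<close> each new vertex has just one colour to avoid, and a permutation of
  the second colouring meets both demands. If no edge crosses, the identity serves.\<close>

lemma limited_colouring_join:
  fixes c\<^sub>1 c\<^sub>2 :: "'a \<Rightarrow> colour"
  assumes V: "finite V" "symp E" "irreflp E" "\<And>v. v \<in> V \<Longrightarrow> card (nbrs V E v) \<le> 3"
    and Q: "one_edge_cut V E Q"
    and c: "limited_colouring Q E c\<^sub>1" "limited_colouring (V - Q) E c\<^sub>2"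
  shows "\<exists>c :: 'a \<Rightarrow> colour. limited_colouring V E c"
proof -
  have sym: "E u v \<Longrightarrow> E v u" for u v using V(2) by (auto dest: sympD)
  have irr: "\<not> E v v" for v using V(3) by (auto dest: irreflpD)
  obtain u\<^sub>0 v\<^sub>0 where cut: "\<And>u v. u \<in> Q \<Longrightarrow> v \<in> V - Q \<Longrightarrow> E u v \<Longrightarrow> u = u\<^sub>0 \<and> v = v\<^sub>0"
    using Q unfolding one_edge_cut_def by blast
  have cut': "u = u\<^sub>0 \<and> v = v\<^sub>0" if "u \<in> Q" "v \<in> V - Q" "E v u" for u v
    using cut[OF that(1,2) sym[OF that(3)]] .
  have QV: "Q \<subseteq> V" using Q by (auto simp: one_edge_cut_def)
  have same: "nbrs V E v = nbrs Q E v" if "v \<in> Q" "v \<noteq> u\<^sub>0 \<or> v\<^sub>0 \<notin> V - Q \<or> \<not> E u\<^sub>0 v\<^sub>0" for v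
    using that cut[of v] QV by (auto simp: nbrs_def)
  have same': "nbrs V E v = nbrs (V - Q) E v" if "v \<in> V - Q" "v \<noteq> v\<^sub>0 \<or> u\<^sub>0 \<notin> Q \<or> \<not> E u\<^sub>0 v\<^sub>0" for v
  proof -
    have "u \<notin> Q" if "E v u" for u
      using cut'[of u v] that \<open>v \<in> V - Q\<close> sym[OF that] \<open>v \<noteq> v\<^sub>0 \<or> u\<^sub>0 \<notin> Q \<or> \<not> E u\<^sub>0 v\<^sub>0\<close> by blast
    then show ?thesis by (auto simp: nbrs_def)
  qed
  have sub: "insert v (nbrs Q E v) \<subseteq> Q" if "v \<in> Q" for v using that by (auto simp: nbrs_def)
  have sub': "insert v (nbrs (V - Q) E v) \<subseteq> V - Q" if "v \<in> V - Q" for v using that by (auto simp: nbrs_def)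
  have nbrs\<^sub>0: "nbrs V E u\<^sub>0 = insert v\<^sub>0 (nbrs Q E u\<^sub>0)" "nbrs V E v\<^sub>0 = insert u\<^sub>0 (nbrs (V - Q) E v\<^sub>0)"
    if uv: "u\<^sub>0 \<in> Q" "v\<^sub>0 \<in> V - Q" "E u\<^sub>0 v\<^sub>0"
  proof -
    have "v \<in> Q" if "v \<in> V" "v \<noteq> v\<^sub>0" "E u\<^sub>0 v" for v using cut[of u\<^sub>0 v] uv(1) that by blast
    then show "nbrs V E u\<^sub>0 = insert v\<^sub>0 (nbrs Q E u\<^sub>0)" using uv QV by (auto simp: nbrs_def)
    have "u \<notin> Q" if "u \<noteq> u\<^sub>0" "E v\<^sub>0 u" for u using cut'[of u v\<^sub>0] uv(2) that by blast
    then show "nbrs V E v\<^sub>0 = insert u\<^sub>0 (nbrs (V - Q) E v\<^sub>0)"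
      using uv sym[OF uv(3)] QV by (auto simp: nbrs_def)
  qed
  define A B where "A = insert u\<^sub>0 (nbrs Q E u\<^sub>0)" and "B = insert v\<^sub>0 (nbrs (V - Q) E v\<^sub>0)"
  have "\<exists>\<sigma>. inj \<sigma> \<and> (u\<^sub>0 \<in> Q \<longrightarrow> v\<^sub>0 \<in> V - Q \<longrightarrow> E u\<^sub>0 v\<^sub>0 \<longrightarrow>
     (\<forall>x\<in>A. \<forall>y\<in>A. x \<noteq> y \<longrightarrow> c\<^sub>1 x = c\<^sub>1 y \<longrightarrow> \<sigma> (c\<^sub>2 v\<^sub>0) \<noteq> c\<^sub>1 x) \<and>
     (\<forall>x\<in>B. \<forall>y\<in>B. x \<noteq> y \<longrightarrow> c\<^sub>2 x = c\<^sub>2 y \<longrightarrow> \<sigma> (c\<^sub>2 x) \<noteq> c\<^sub>1 u\<^sub>0))"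
  proof (cases "u\<^sub>0 \<in> Q \<and> v\<^sub>0 \<in> V - Q \<and> E u\<^sub>0 v\<^sub>0")
    case True
    \<comment> \<open>Within its side, an end has lost one neighbour but counts itself, so its
      closed neighbourhood is as large as its degree in \<open>V\<close>.\<close>
    have "card A = card (nbrs V E u\<^sub>0)" "card B = card (nbrs V E v\<^sub>0)" "finite A" "finite B"
      using nbrs\<^sub>0 True irr V(1) finite_subset[OF QV V(1)] by (auto simp: A_def B_def nbrs_def card_insert_if)
    then have fin: "finite A" "card A \<le> 3" "finite B" "card B \<le> 3" using V(4) True QV by auto
    obtain i where i: "\<forall>x\<in>A. \<forall>y\<in>A. x \<noteq> y \<longrightarrow> c\<^sub>1 x = c\<^sub>1 y \<longrightarrow> c\<^sub>1 x = i"
      using repeated_colour[OF fin(1,2), of c\<^sub>1] by blast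
    obtain j where j: "\<forall>x\<in>B. \<forall>y\<in>B. x \<noteq> y \<longrightarrow> c\<^sub>2 x = c\<^sub>2 y \<longrightarrow> c\<^sub>2 x = j"
      using repeated_colour[OF fin(3,4), of c\<^sub>2] by blast
    have "\<exists>\<sigma> :: colour \<Rightarrow> colour. inj \<sigma> \<and> \<sigma> (c\<^sub>2 v\<^sub>0) \<noteq> i \<and> \<sigma> j \<noteq> c\<^sub>1 u\<^sub>0"
    \<comment> \<open>If both demands concern the same colour, its image must avoid two colours, and
      a third one is left. Otherwise two images are chosen in turn.\<close>
    proof (cases "c\<^sub>2 v\<^sub>0 = j")
      case True
      obtain k where "k \<noteq> i" "k \<noteq> c\<^sub>1 u\<^sub>0" using ex_colour_neq2 by blast
      then show ?thesis using True ex_inj_map1[of j k] by auto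
    next
      case False
      obtain k where k: "k \<noteq> i" using ex_three_colours by metis
      obtain l where "l \<noteq> k" "l \<noteq> c\<^sub>1 u\<^sub>0" using ex_colour_neq2 by blast
      then show ?thesis using k ex_inj_map2[OF False, of k l] by auto
    qed
    then show ?thesis using i j by metis
  next
    case False
    then show ?thesis by (intro exI[of _ id]) auto
  qed
  then obtain \<sigma> where \<sigma>: "inj \<sigma>"
    and \<sigma>A: "\<And>x y. \<lbrakk>u\<^sub>0 \<in> Q; v\<^sub>0 \<in> V - Q; E u\<^sub>0 v\<^sub>0; x \<in> A; y \<in> A; x \<noteq> y; c\<^sub>1 x = c\<^sub>1 y\<rbrakk> \<Longrightarrow> \<sigma> (c\<^sub>2 v\<^sub>0) \<noteq> c\<^sub>1 x"
    and \<sigma>B: "\<And>x y. \<lbrakk>u\<^sub>0 \<in> Q; v\<^sub>0 \<in> V - Q; E u\<^sub>0 v\<^sub>0; x \<in> B; y \<in> B; x \<noteq> y; c\<^sub>2 x = c\<^sub>2 y\<rbrakk> \<Longrightarrow> \<sigma> (c\<^sub>2 x) \<noteq> c\<^sub>1 u\<^sub>0"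
    by blast
  let ?c = "\<lambda>v. if v \<in> Q then c\<^sub>1 v else \<sigma> (c\<^sub>2 v)"
  have c1: "limited_colouring Q E ?c"
    using limited_colouring_cong[of Q ?c c\<^sub>1] c(1) by simp
  have c2: "limited_colouring (V - Q) E ?c"
    using limited_colouring_cong[of "V - Q" ?c "\<lambda>v. \<sigma> (c\<^sub>2 v)"] limited_colouring_inj[OF c(2) \<sigma>] by simp
  have "limited_colouring V E ?c"
    unfolding limited_colouring_def
  proof (rule ballI)
    fix v assume v: "v \<in> V"
    show "no_triple ?c (insert v (nbrs V E v))"
    proof (cases "u\<^sub>0 \<in> Q \<and> v\<^sub>0 \<in> V - Q \<and> E u\<^sub>0 v\<^sub>0 \<and> v \<in> {u\<^sub>0, v\<^sub>0}")
      case False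
      show ?thesis
      proof (cases "v \<in> Q")
        case True
        have "nbrs V E v = nbrs Q E v" using True False by (intro same) auto
        then show ?thesis using True c1 unfolding limited_colouring_def by simp
      next
        case False': False
        have "nbrs V E v = nbrs (V - Q) E v" using False False' v by (intro same') auto
        then show ?thesis using False' v c2 unfolding limited_colouring_def by simp
      qed
    next
      case True
      show ?thesis
      proof (cases "v = u\<^sub>0")
        case v: True
        have "no_triple ?c A" using c1 True unfolding limited_colouring_def A_def by blast
        moreover have "insert v (nbrs V E v) = insert v\<^sub>0 A"
          using v True nbrs\<^sub>0(1) by (auto simp: A_def)
        moreover have "x \<in> Q" if "x \<in> A" for x using that True by (auto simp: A_def nbrs_def)
        ultimately show ?thesis using no_triple_insert[of ?c A v\<^sub>0] \<sigma>A True by auto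
      next
        case False
        then have v: "v = v\<^sub>0" using True by auto
        have nB: "no_triple ?c B" using c2 True unfolding limited_colouring_def B_def by blast
        have eq: "insert v (nbrs V E v) = insert u\<^sub>0 B"
          using v True nbrs\<^sub>0(2) by (auto simp: B_def)
        have BQ: "x \<notin> Q" if "x \<in> B" for x using that True by (auto simp: B_def nbrs_def)
        have new: "?c u\<^sub>0 \<noteq> ?c x" if "x \<in> B" "y \<in> B" "x \<noteq> y" "?c x = ?c y" for x y
        proof -
          have "c\<^sub>2 x = c\<^sub>2 y" using that BQ[OF that(1)] BQ[OF that(2)] \<sigma> by (simp add: inj_eq)
          then show ?thesis using \<sigma>B[of x y] that(1-3) True BQ[OF that(1)] by (simp add: eq_commute)
        qed
        show ?thesis unfolding eq using nB new by (rule no_triple_insert)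
      qed
    qed
  qed
  then show ?thesis by blast
qed


section \<open>A matching that covers all vertices of degree three\<close>

lemma even_card_symmetric:
  assumes "finite Q" "symp E" "irreflp E"
  shows "even (card {(u, v). u \<in> Q \<and> v \<in> Q \<and> E u v})"
  using assms(1)
proof induction
  case (insert x Q)
  let ?A = "{(u, v). u \<in> Q \<and> v \<in> Q \<and> E u v}" and ?N = "nbrs Q E x"
  have irr: "\<not> E x x" using assms(3) by (auto dest: irreflpD)
  have fin: "finite ?A" using insert.hyps(1) by (auto intro: finite_subset[of _ "Q \<times> Q"])
  have "{(u, v). u \<in> insert x Q \<and> v \<in> insert x Q \<and> E u v} = ?A \<union> ({x} \<times> ?N \<union> ?N \<times> {x})"
    using irr sympD[OF assms(2)] by (auto simp: nbrs_def)
  also have "card \<dots> = card ?A + card ({x} \<times> ?N \<union> ?N \<times> {x})"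
    using insert.hyps fin by (intro card_Un_disjoint) (auto simp: nbrs_def)
  also have "card ({x} \<times> ?N \<union> ?N \<times> {x}) = card ({x} \<times> ?N) + card (?N \<times> {x})"
    using insert.hyps by (intro card_Un_disjoint) (auto simp: nbrs_def)
  finally show ?case using insert.IH by (simp add: card_cartesian_product)
qed simp

text \<open>The degree sum \<open>3 * card Q\<close> is odd and the edges inside \<open>Q\<close>
  contribute an even amount, so an odd number of edges leave \<open>Q\<close>. A single one would be
  a one-edge cut.\<close>

lemma odd_cubic_set_leaving_edges:
  assumes V: "finite V" "symp E" "irreflp E" and Q: "Q \<subseteq> V" "odd (card Q)"
    and deg: "\<And>v. v \<in> Q \<Longrightarrow> card (nbrs V E v) = 3" and cut: "\<not> one_edge_cut V E Q"
  shows "3 \<le> card {(u, v). u \<in> Q \<and> v \<in> V - Q \<and> E u v}"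
proof -
  let ?I = "{(u, v). u \<in> Q \<and> v \<in> Q \<and> E u v}" and ?O = "{(u, v). u \<in> Q \<and> v \<in> V - Q \<and> E u v}"
  have fQ: "finite Q" using Q(1) V(1) finite_subset by blast
  have fin: "finite ?I" "finite ?O"
    using fQ V(1) by (auto intro: finite_subset[of _ "Q \<times> Q"] finite_subset[of _ "Q \<times> V"])
  have "(SIGMA u:Q. nbrs V E u) = ?I \<union> ?O" using Q(1) by (auto simp: nbrs_def)
  moreover have "card (SIGMA u:Q. nbrs V E u) = 3 * card Q"
    using fQ V(1) deg by (subst card_SigmaI) auto
  moreover have "card (?I \<union> ?O) = card ?I + card ?O" using fin by (intro card_Un_disjoint) auto
  ultimately have "card ?I + card ?O = 3 * card Q" by simp
  then have "even (card ?I + card ?O) \<longleftrightarrow> even (3 * card Q)" by (rule arg_cong)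
  then have odd: "odd (card ?O)"
    using even_card_symmetric[OF fQ V(2,3)] Q(2) unfolding even_add even_mult_iff by simp
  then have ne: "?O \<noteq> {}" by (metis card.empty even_zero)
  have "card ?O \<noteq> 1"
  proof
    assume "card ?O = 1"
    then obtain p where p: "?O = {p}" using card_1_singletonE by blast
    have "\<forall>u\<in>Q. \<forall>v\<in>V - Q. E u v \<longrightarrow> u = fst p \<and> v = snd p"
    proof (intro ballI impI)
      fix u v assume "u \<in> Q" "v \<in> V - Q" "E u v"
      then have "(u, v) \<in> ?O" by simp
      then have "(u, v) = p" using p by blast
      then show "u = fst p \<and> v = snd p" by auto
    qed
    moreover have "Q \<noteq> {}" "Q \<subset> V" using ne Q(1) by auto
    ultimately show False using cut unfolding one_edge_cut_def by blast
  qed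
  moreover have "card ?O \<noteq> 0" "card ?O \<noteq> 2" using odd by (metis even_zero, metis even_numeral)
  ultimately show ?thesis by linarith
qed

text \<open>Fixed points of \<open>m\<close> stand for unmatched vertices. If there were no
  matching, Tutte's theorem would give a set \<open>S\<close> with at least
  \<open>card S + 1\<close> odd classes of cubic vertices. Each sends three edges into
  \<open>S\<close>, but \<open>S\<close> can receive only \<open>3 * card S\<close>.\<close>

lemma ex_matching_covering_cubic:
  fixes E :: "'a \<Rightarrow> 'a \<Rightarrow> bool"
  assumes V: "finite V" "symp E" "irreflp E" "\<And>v. v \<in> V \<Longrightarrow> card (nbrs V E v) \<le> 3"
    and cut: "\<And>Q. \<not> one_edge_cut V E Q"
  shows "\<exists>m. (\<forall>v. m (m v) = v) \<and>
    (\<forall>v\<in>V. m v \<in> V \<and> (m v \<noteq> v \<longrightarrow> E v (m v)) \<and> (m v = v \<longrightarrow> card (nbrs V E v) \<le> 2))"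
proof -
  have sym: "E u v \<Longrightarrow> E v u" for u v using V(2) by (auto dest: sympD)
  have irr: "\<not> E v v" for v using V(3) by (auto dest: irreflpD)
  (* Tutte's theorem is applied after making the vertices of degree at most 2 a clique, together
     with a dummy vertex None if card V is odd; only one class can then meet this clique. *)
  define L where "L = insert None (Some ` {v \<in> V. card (nbrs V E v) \<le> 2})"
  define U where "U = Some ` V \<union> (if odd (card V) then {None} else {})"
  define R where "R = (\<lambda>a b. a \<noteq> b \<and> (a \<in> L \<and> b \<in> L \<or> (\<exists>u v. a = Some u \<and> b = Some v \<and> E u v)))"
  have fU: "finite U" using V(1) by (auto simp: U_def)
  have "None \<notin> Some ` V" by auto
  then have eU: "even (card U)"
    using V(1) by (cases "odd (card V)") (simp_all add: U_def card_image card_insert_if)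
  have R: "symp R" "irreflp R" using sym by (auto simp: R_def symp_def irreflp_def)
  show ?thesis
  proof (cases "\<exists>M. perfect_matching U R M")
    case True
    then obtain M where M: "\<And>a. M (M a) = a" "\<And>a. a \<in> U \<Longrightarrow> M a \<in> U \<and> R a (M a)"
      by (auto simp: perfect_matching_def)
    have SU: "Some v \<in> U \<longleftrightarrow> v \<in> V" for v by (auto simp: U_def)
    \<comment> \<open>Pairs of \<open>M\<close> that are edges of \<open>E\<close> are kept; all
      other vertices were matched inside the clique \<open>L\<close> and become fixed
      points.\<close>
    define m where "m = (\<lambda>v. if v \<in> V \<and> M (Some v) \<noteq> None \<and> E v (the (M (Some v))) then the (M (Some v)) else v)"
    have m1: "m v \<in> V \<and> E v (m v) \<and> M (Some v) = Some (m v) \<and> m (m v) = v" if mv: "m v \<noteq> v" for v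
    proof -
      obtain w where w: "v \<in> V" "M (Some v) = Some w" "E v w" "m v = w"
        using mv by (auto simp: m_def split: if_splits)
      have "w \<in> V" using M(2)[of "Some v"] w SU by simp
      moreover have "M (Some w) = Some v" using M(1)[of "Some v"] w(2) by simp
      ultimately show ?thesis using w sym[OF w(3)] by (simp add: m_def)
    qed
    show ?thesis
    proof (intro exI[of _ m] conjI allI ballI impI)
      show "m (m v) = v" for v using m1[of v] by (cases "m v = v") auto
    next
      fix v assume v: "v \<in> V"
      show "m v \<in> V" using m1[of v] v by (cases "m v = v") auto
      show "E v (m v)" if "m v \<noteq> v" using m1[OF that] by simp
      show "card (nbrs V E v) \<le> 2" if mv: "m v = v"
      proof -
        have "R (Some v) (M (Some v))" using M(2) SU v by blast
        moreover have "\<not> (\<exists>w. M (Some v) = Some w \<and> E v w)"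
        proof
          assume "\<exists>w. M (Some v) = Some w \<and> E v w"
          then obtain w where "M (Some v) = Some w" "E v w" by blast
          then show False using mv v irr by (auto simp: m_def)
        qed
        ultimately show ?thesis by (auto simp: R_def L_def)
      qed
    qed
  next
    case False
    then obtain S and f :: "'a option \<Rightarrow> 'a option set" where S: "S \<subseteq> U"
      and less: "card S < card (odd_classes (U - S) f)"
      and f: "\<And>a b. a \<in> U - S \<Longrightarrow> b \<in> U - S \<Longrightarrow> R a b \<Longrightarrow> f a = f b"
      using tutte[OF fU eU R] by metis
    let ?O = "odd_classes (U - S) f"
    have fS: "finite S" using S fU finite_subset by blast
    have fO: "finite ?O" using fU by (intro finite_odd_classes) simp
    have "even (card ?O) \<longleftrightarrow> even (card (U - S))" using fU by (intro even_card_odd_classes) simp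
    also have "card (U - S) = card U - card S" using fS S by (rule card_Diff_subset)
    also have "even (card U - card S) \<longleftrightarrow> even (card S)"
      using eU card_mono[OF fU S] by (simp add: even_diff_nat)
    \<comment> \<open>Parity improves the excess from one to two, which allows for discarding the
      one class that may meet \<open>L\<close>.\<close>
    finally have O2: "card ?O \<ge> card S + 2"
      using less by (metis Suc_leI add_2_eq_Suc' even_Suc le_neq_implies_less)
    \<comment> \<open>The odd classes without a member in \<open>L\<close>, so that all their
      members are vertices of degree three.\<close>
    define K where "K = ?O - f ` ((U - S) \<inter> L)"
    have "f a = f b" if "a \<in> (U - S) \<inter> L" "b \<in> (U - S) \<inter> L" for a b
      using f[of a b] that by (cases "a = b") (auto simp: R_def)
    then have "\<exists>k. \<forall>a\<in>(U - S) \<inter> L. f a = k" by metis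
    then obtain k where "f ` ((U - S) \<inter> L) \<subseteq> {k}" by blast
    then have "?O \<subseteq> insert k K" by (auto simp: K_def)
    then have "card ?O \<le> Suc (card K)"
      using card_mono[of "insert k K" ?O] card_insert_le_m1[of "Suc (card K)" K k] fO by (simp add: K_def)
    then have K: "card S + 1 \<le> card K" "finite K" using O2 fO by (auto simp: K_def)
    define Q where "Q k = {v \<in> V. Some v \<in> U - S \<and> f (Some v) = k}" for k
    define D where "D k = {(u, v). u \<in> Q k \<and> v \<in> V - Q k \<and> E u v}" for k
    have QL: "a \<notin> L" if "a \<in> U - S" "f a = k" "k \<in> K" for a k
      using that by (auto simp: K_def)
    have D3: "3 \<le> card (D k)" if k: "k \<in> K" for k
    proof -
      have "{a \<in> U - S. f a = k} = Some ` Q k"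
      proof (intro equalityI subsetI)
        fix a assume a: "a \<in> {a \<in> U - S. f a = k}"
        then have "a \<notin> L" using QL k by blast
        then have "a \<noteq> None" by (auto simp: L_def)
        then obtain v where "a = Some v" by blast
        then show "a \<in> Some ` Q k" using a by (auto simp: Q_def U_def split: if_splits)
      qed (auto simp: Q_def)
      then have "odd (card (Q k))"
        using k by (auto simp: K_def odd_classes_def card_image)
      moreover have "card (nbrs V E v) = 3" if "v \<in> Q k" for v
      proof -
        have "Some v \<notin> L" "v \<in> V" using that QL[of "Some v" k] k by (auto simp: Q_def)
        then have "\<not> card (nbrs V E v) \<le> 2" by (auto simp: L_def)
        then show ?thesis using V(4)[OF \<open>v \<in> V\<close>] by linarith
      qed
      ultimately show ?thesis
        unfolding D_def using V(1-3) cut by (intro odd_cubic_set_leaving_edges) (auto simp: Q_def)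
    qed
    define T where "T = {v \<in> V. Some v \<in> S}"
    have fT: "finite T" using V(1) by (simp add: T_def)
    have TS: "card T \<le> card S"
    proof -
      have "card T = card (Some ` T)" by (simp add: card_image)
      also have "\<dots> \<le> card S" using fS by (intro card_mono) (auto simp: T_def)
      finally show ?thesis .
    qed
    have fD: "finite (D k)" for k
      using V(1) by (auto simp: D_def Q_def intro: finite_subset[of _ "V \<times> V"])
    have "3 * card K = (\<Sum>k\<in>K. 3)" by simp
    also have "\<dots> \<le> (\<Sum>k\<in>K. card (D k))" using D3 by (intro sum_mono)
    also have "\<dots> = card (\<Union>k\<in>K. D k)"
      using K(2) fD by (intro card_UN_disjoint[symmetric]) (auto simp: D_def Q_def)
    \<comment> \<open>As \<open>f\<close> is constant along edges outside \<open>S\<close>, an edge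
      that leaves a class ends in \<open>S\<close>; it is counted from that end.\<close>
    also have "\<dots> \<le> card (prod.swap ` (SIGMA v:T. nbrs V E v))"
    proof (intro card_mono)
      show "finite (prod.swap ` (SIGMA v:T. nbrs V E v))" using fT V(1) by auto
      show "(\<Union>k\<in>K. D k) \<subseteq> prod.swap ` (SIGMA v:T. nbrs V E v)"
      proof
        fix p assume "p \<in> (\<Union>k\<in>K. D k)"
        then obtain k u v where uv: "p = (u, v)" "u \<in> Q k" "v \<in> V - Q k" "E u v" by (auto simp: D_def)
        have "Some v \<in> S"
        proof (rule ccontr)
          assume "Some v \<notin> S"
          then have "Some v \<in> U - S" using uv(3) by (auto simp: U_def)
          moreover have "R (Some u) (Some v)" using uv(4) irr by (auto simp: R_def)
          ultimately have "f (Some v) = k" using uv(2) f[of "Some u" "Some v"] by (auto simp: Q_def)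
          then show False using uv(3) \<open>Some v \<in> U - S\<close> by (auto simp: Q_def)
        qed
        then have "(v, u) \<in> (SIGMA v:T. nbrs V E v)"
          using uv sym[OF uv(4)] by (auto simp: T_def nbrs_def Q_def)
        then show "p \<in> prod.swap ` (SIGMA v:T. nbrs V E v)" using uv(1) by force
      qed
    qed
    also have "\<dots> = (\<Sum>v\<in>T. card (nbrs V E v))"
      using fT V(1) by (subst card_image) (auto simp: card_SigmaI)
    also have "\<dots> \<le> (\<Sum>v\<in>T. 3)" using V(4) by (intro sum_mono) (auto simp: T_def)
    also have "\<dots> \<le> 3 * card S" using TS by simp
    finally show ?thesis using K(1) by linarith
  qed
qed

section \<open>The graph \<open>H\<close> of pairs defined by a matching\<close>

locale subcubic_matching =
  fixes V :: "'a set" and E :: "'a \<Rightarrow> 'a \<Rightarrow> bool" and m :: "'a \<Rightarrow> 'a"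
  assumes finite_V: "finite V" and sym_E: "symp E" and irrefl_E: "irreflp E"
    and deg_le_3: "v \<in> V \<Longrightarrow> card (nbrs V E v) \<le> 3"
    and m_m [simp]: "m (m v) = v"
    and m_V: "v \<in> V \<Longrightarrow> m v \<in> V"
    and m_E: "v \<in> V \<Longrightarrow> m v \<noteq> v \<Longrightarrow> E v (m v)"
    and deg_le_2: "v \<in> V \<Longrightarrow> m v = v \<Longrightarrow> card (nbrs V E v) \<le> 2"
begin

text \<open>The pair that remains of \<open>N[x]\<close> besides \<open>x\<close> and
  \<open>m x\<close>, if exactly two neighbours remain. At an unmatched \<open>x\<close>, where
  \<open>m x = x\<close>, no neighbour is taken away.\<close>

definition opposite :: "'a \<Rightarrow> 'a \<Rightarrow> 'a \<Rightarrow> bool" where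
  "opposite x u w \<longleftrightarrow> x \<in> V \<and> u \<noteq> w \<and> nbrs V E x - {m x} = {u, w}"

definition H :: "'a \<Rightarrow> 'a \<Rightarrow> bool" where
  "H u w \<longleftrightarrow> u \<noteq> w \<and> (m u = w \<or> (\<exists>x. opposite x u w))"

lemma E_sym: "E u v \<Longrightarrow> E v u"
  using sym_E by (auto dest: sympD)

lemma E_irrefl: "\<not> E v v"
  using irrefl_E by (auto dest: irreflpD)

lemma opposite_sym: "opposite x u w \<Longrightarrow> opposite x w u"
  by (auto simp: opposite_def insert_commute)

lemma oppositeD:
  assumes "opposite x u w"
  shows "x \<in> V" "u \<in> V" "w \<in> V" "u \<noteq> w" "E x u" "E x w" "E u x" "E w x" "m x \<noteq> u" "m x \<noteq> w"
    "x \<noteq> u" "x \<noteq> w" "m u \<noteq> x" "m w \<noteq> x"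
proof -
  have "u \<in> nbrs V E x - {m x}" "w \<in> nbrs V E x - {m x}" using assms by (auto simp: opposite_def)
  then show *: "u \<in> V" "w \<in> V" "E x u" "E x w" "m x \<noteq> u" "m x \<noteq> w" by (auto simp: nbrs_def)
  show "x \<in> V" "u \<noteq> w" using assms by (auto simp: opposite_def)
  show "E u x" "E w x" using * E_sym by auto
  show "x \<noteq> u" "x \<noteq> w" using * E_irrefl by auto
  show "m u \<noteq> x" "m w \<noteq> x" using * by auto
qed

lemma opposite_cases:
  assumes "opposite x u w" "opposite x u' w'"
  shows "{u, w} = {u', w'}"
  using assms by (simp add: opposite_def)

lemma nbrs_opposite:
  assumes "opposite x u w" shows "nbrs V E x \<subseteq> {m x, u, w}"
  using assms by (auto simp: opposite_def)

lemma symp_H: "symp H"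
proof (rule sympI)
  fix u w assume "H u w"
  then show "H w u" unfolding H_def using opposite_sym by fastforce
qed

lemma irreflp_H: "irreflp H"
  by (auto simp: H_def irreflp_def)

text \<open>Every opposite pair that contains \<open>u\<close> belongs to a neighbour
  \<open>x\<close> of \<open>u\<close> other than \<open>m u\<close>, and \<open>x\<close>
  determines its second element \<open>other x\<close>. The first summand vanishes at an unmatched
  \<open>u\<close>, which \<open>K4_matched\<close> exploits.\<close>

lemma card_nbrs_H:
  assumes u: "u \<in> V"
  shows "card (nbrs V H u) \<le> card ({m u} - {u}) + card (nbrs V E u - {m u})"
proof -
  define other where "other x = (SOME w. opposite x u w)" for x
  have "nbrs V H u \<subseteq> ({m u} - {u}) \<union> other ` (nbrs V E u - {m u})"
  proof
    fix w assume w: "w \<in> nbrs V H u"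
    show "w \<in> ({m u} - {u}) \<union> other ` (nbrs V E u - {m u})"
    proof (cases "m u = w")
      case True
      then show ?thesis using w by (auto simp: nbrs_def H_def)
    next
      case False
      then obtain x where x: "opposite x u w" using w by (auto simp: nbrs_def H_def)
      have "opposite x u (other x)" unfolding other_def using x by (rule someI)
      then have "{u, w} = {u, other x}" "u \<noteq> other x" using opposite_cases[OF x] oppositeD(4) by blast+
      then have "other x = w" using oppositeD(4)[OF x] by (auto simp: doubleton_eq_iff)
      moreover have "x \<in> nbrs V E u - {m u}" using oppositeD[OF x] by (auto simp: nbrs_def)
      ultimately show ?thesis by blast
    qed
  qed
  then have "card (nbrs V H u) \<le> card (({m u} - {u}) \<union> other ` (nbrs V E u - {m u}))"
    using finite_V by (intro card_mono) auto
  also have "\<dots> \<le> card ({m u} - {u}) + card (other ` (nbrs V E u - {m u}))" by (rule card_Un_le)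
  also have "card (other ` (nbrs V E u - {m u})) \<le> card (nbrs V E u - {m u})"
    using finite_V by (intro card_image_le) auto
  finally show ?thesis by simp
qed

lemma card_nbrs_minus_match:
  assumes "u \<in> V" shows "card (nbrs V E u - {m u}) \<le> 2"
proof (cases "m u = u")
  case True
  then have "nbrs V E u - {m u} = nbrs V E u" using E_irrefl by (auto simp: nbrs_def)
  then show ?thesis using deg_le_2[OF assms True] by simp
next
  case False
  then have "m u \<in> nbrs V E u" using m_E m_V assms by (auto simp: nbrs_def)
  then have "card (nbrs V E u - {m u}) = card (nbrs V E u) - 1" by simp
  then show ?thesis using deg_le_3[OF assms] by simp
qed

lemma card_nbrs_H_le_3:
  assumes "u \<in> V" shows "card (nbrs V H u) \<le> 3"
proof -
  have "card ({m u} - {u}) \<le> 1" by (cases "m u = u") auto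
  then show ?thesis using card_nbrs_H[OF assms] card_nbrs_minus_match[OF assms] by linarith
qed

text \<open>A monochromatic triple in \<open>N[v]\<close> contains at most one of \<open>v\<close>
  and \<open>m v\<close>, hence exactly one of them and the whole opposite pair. The second
  condition is weaker than properness on \<open>H\<close>, which leaves room for colouring a
  K4.\<close>

lemma limited_colouringI:
  assumes match: "\<And>v. v \<in> V \<Longrightarrow> m v \<noteq> v \<Longrightarrow> c v \<noteq> c (m v)"
    and opp: "\<And>x u w. opposite x u w \<Longrightarrow> c u \<noteq> c w \<or> c u \<notin> {c x, c (m x)}"
  shows "limited_colouring V E c"
  unfolding limited_colouring_def
proof
  fix v assume v: "v \<in> V"
  let ?D = "nbrs V E v - {m v}"
  have sub: "insert v (nbrs V E v) \<subseteq> insert v (insert (m v) ?D)" by auto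
  have pair: "c v \<noteq> c (m v)" if "m v \<noteq> v" using match[OF v that] .
  \<comment> \<open>The choice \<open>a = b\<close> covers the case of fewer than two other
    neighbours.\<close>
  have "\<exists>a b. ?D \<subseteq> {a, b} \<and> (a \<noteq> b \<longrightarrow> ?D = {a, b})"
  proof -
    consider "card ?D = 0" | "card ?D = 1" | "card ?D = 2" using card_nbrs_minus_match[OF v] by linarith
    then show ?thesis
    proof cases
      case 1
      then have "?D = {}" using finite_V by simp
      then show ?thesis by blast
    next
      case 2
      then obtain a where "?D = {a}" using card_1_singletonE by blast
      then show ?thesis by blast
    next
      case 3
      then obtain a b where "?D = {a, b}" using card_2_iff by metis
      then show ?thesis by blast
    qed
  qed
  then obtain a b where ab: "?D \<subseteq> {a, b}" "a \<noteq> b \<longrightarrow> ?D = {a, b}" by blast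
  have ne: "c a \<noteq> c b \<or> c a \<notin> {c v, c (m v)}" if "a \<noteq> b"
    using opp[of v a b] that ab v by (simp add: opposite_def)
  show "no_triple c (insert v (nbrs V E v))"
    unfolding no_triple_def
  proof (intro ballI impI notI)
    fix x y z assume xyz: "x \<in> insert v (nbrs V E v)" "y \<in> insert v (nbrs V E v)" "z \<in> insert v (nbrs V E v)"
      "x \<noteq> y" "x \<noteq> z" "y \<noteq> z" "c x = c y" "c x = c z"
    have in4: "x \<in> {v, m v, a, b}" "y \<in> {v, m v, a, b}" "z \<in> {v, m v, a, b}"
      using xyz(1-3) sub ab(1) by blast+
    have two: "m v \<notin> {x, y, z}" if "v \<in> {x, y, z}" "m v \<noteq> v"
      using pair that xyz(7,8) by auto
    have "\<exists>w\<in>{v, m v}. {x, y, z} \<subseteq> {w, a, b}"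
    proof (cases "v \<in> {x, y, z}")
      case True
      then have "{x, y, z} \<subseteq> {v, a, b}" using in4 two[OF True] by (cases "m v = v") blast+
      then show ?thesis by blast
    next
      case False
      then have "{x, y, z} \<subseteq> {m v, a, b}" using in4 by blast
      then show ?thesis by blast
    qed
    then obtain w where w: "w \<in> {v, m v}" "{x, y, z} \<subseteq> {w, a, b}" by blast
    have "card {x, y, z} = 3" using xyz(4-6) by simp
    moreover have "card {x, y, z} \<le> card {w, a, b}" using w(2) by (intro card_mono) auto
    ultimately have "{x, y, z} = {w, a, b}" "a \<noteq> b"
      using w(2) card_seteq[of "{w, a, b}" "{x, y, z}"] by (auto simp: card_insert_if split: if_splits)
    then have "w \<in> {x, y, z} \<and> a \<in> {x, y, z} \<and> b \<in> {x, y, z} \<and> a \<noteq> b" by blast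
    then have "c a = c b" "c a = c w" "a \<noteq> b" using xyz(7,8) by auto
    with w(1) ne show False by auto
  qed
qed

(* A K4 of H: the cycle p a r b q c s d of G together with the matching edges pq and rs. *)
definition square :: "'a \<Rightarrow> 'a \<Rightarrow> 'a \<Rightarrow> 'a \<Rightarrow> 'a \<Rightarrow> 'a \<Rightarrow> 'a \<Rightarrow> 'a \<Rightarrow> bool" where
  "square p q r s a b c d \<longleftrightarrow> m p = q \<and> m r = s \<and> p \<noteq> q \<and> r \<noteq> s \<and>
     opposite a p r \<and> opposite b r q \<and> opposite c q s \<and> opposite d s p"

text \<open>These symmetries bring each of the four corners to the first place, so that facts about
  \<open>p\<close> carry over to \<open>q\<close>, \<open>r\<close> and \<open>s\<close>.\<close>

lemma square_flip: "square p q r s a b c d \<Longrightarrow> square q p r s b a d c"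
  using m_m by (auto simp: square_def intro: opposite_sym)

lemma square_swap: "square p q r s a b c d \<Longrightarrow> square r s p q a d c b"
  by (auto simp: square_def intro: opposite_sym)

lemma square_flip': "square p q r s a b c d \<Longrightarrow> square p q s r d c b a"
  using square_swap[OF square_flip[OF square_swap]] .

lemma square_neq:
  assumes "square p q r s a b c d"
  shows "p \<noteq> q" "p \<noteq> r" "p \<noteq> s" "q \<noteq> r" "q \<noteq> s" "r \<noteq> s"
  using assms oppositeD(4) unfolding square_def by blast+

lemma square_V:
  assumes "square p q r s a b c d"
  shows "p \<in> V" "q \<in> V" "r \<in> V" "s \<in> V" "a \<in> V" "b \<in> V" "c \<in> V" "d \<in> V"
  using assms oppositeD(1-3) unfolding square_def by blast+

text \<open>The three vertices are neighbours of \<open>p\<close> and exhaust its degree. They are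
  distinct because a vertex has only one opposite pair and its partner is not in it.\<close>

lemma nbrs_square_corner:
  assumes sq: "square p q r s a b c d"
  shows "nbrs V E p = {q, a, d}" "a \<noteq> d" "a \<noteq> q" "d \<noteq> q"
proof -
  have opp: "opposite a p r" "opposite d s p" and m: "m p = q" "m q = p"
    using sq m_m by (auto simp: square_def)
  show ne: "a \<noteq> q" "d \<noteq> q" using oppositeD(9)[OF opp(1)] oppositeD(10)[OF opp(2)] m by auto
  show "a \<noteq> d"
  proof
    assume "a = d"
    then have "{p, r} = {s, p}" using opposite_cases[OF opp(1)] opp(2) by simp
    then show False using square_neq[OF sq] by (auto simp: doubleton_eq_iff)
  qed
  have "E p q" using m_E[of p] square_V(1)[OF sq] square_neq(1)[OF sq] m by auto
  then have "{q, a, d} \<subseteq> nbrs V E p"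
    using oppositeD[OF opp(1)] oppositeD[OF opp(2)] square_V[OF sq] by (auto simp: nbrs_def)
  moreover have "card (nbrs V E p) \<le> card {q, a, d}"
    using deg_le_3[OF square_V(1)[OF sq]] ne \<open>a \<noteq> d\<close> by simp
  ultimately show "nbrs V E p = {q, a, d}" using finite_V by (intro card_seteq[symmetric]) auto
qed

lemma opposite_at_corner:
  assumes sq: "square p q r s a b c d" and x: "opposite x p w"
  shows "x = a \<and> w = r \<or> x = d \<and> w = s"
proof -
  have "x \<in> nbrs V E p" "m p \<noteq> x" using oppositeD[OF x] by (auto simp: nbrs_def)
  then have "x = a \<or> x = d" using nbrs_square_corner(1)[OF sq] sq by (auto simp: square_def)
  moreover have "w = r" if "x = a"
    using opposite_cases[of a p r p w] x sq that oppositeD(4)[OF x] by (auto simp: square_def doubleton_eq_iff)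
  moreover have "w = s" if "x = d"
    using opposite_cases[of d s p p w] x sq that oppositeD(4)[OF x] by (auto simp: square_def doubleton_eq_iff)
  ultimately show ?thesis by blast
qed

lemma opposite_at_square:
  assumes sq: "square p q r s a b c d" and x: "opposite x u w" and u: "u \<in> {p, q, r, s}"
  shows "x = a \<and> {u, w} = {p, r} \<or> x = b \<and> {u, w} = {r, q} \<or> x = c \<and> {u, w} = {q, s} \<or> x = d \<and> {u, w} = {s, p}"
proof -
  consider "u = p" | "u = q" | "u = r" | "u = s" using u by blast
  then show ?thesis
  proof cases
    case 1
    then show ?thesis using opposite_at_corner[OF sq] x by blast
  next
    case 2
    then show ?thesis using opposite_at_corner[OF square_flip[OF sq]] x by blast
  next
    case 3
    then show ?thesis using opposite_at_corner[OF square_swap[OF sq]] x by blast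
  next
    case 4
    then show ?thesis using opposite_at_corner[OF square_swap[OF square_flip'[OF sq]]] x by blast
  qed
qed

text \<open>The bound three on degrees in \<open>H\<close> is attained inside the square, so a K4 of
  \<open>H\<close> is a component of \<open>H\<close>.\<close>

lemma H_square:
  assumes sq: "square p q r s a b c d"
  shows "nbrs V H p = {q, r, s}"
proof -
  have "H p q" "H p r" "H p s"
    using sq square_neq[OF sq] opposite_sym[of d s p] unfolding H_def square_def by blast+
  then have "{q, r, s} \<subseteq> nbrs V H p" using square_V[OF sq] by (auto simp: nbrs_def)
  moreover have "card (nbrs V H p) \<le> card {q, r, s}"
    using card_nbrs_H_le_3[OF square_V(1)[OF sq]] square_neq[OF sq] by simp
  ultimately show ?thesis using finite_V by (intro card_seteq[symmetric]) auto
qed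

text \<open>An unmatched vertex has degree at most two in \<open>H\<close>, so all vertices of a K4
  are matched, and the partner is one of the three neighbours in \<open>H\<close>.\<close>

lemma K4_matched:
  assumes K: "is_K4 H p b c d" and V: "p \<in> V" "b \<in> V" "c \<in> V" "d \<in> V"
  shows "m p \<noteq> p" "m p \<in> {b, c, d}" "nbrs V H p = {b, c, d}"
proof -
  have ne: "b \<noteq> c" "b \<noteq> d" "c \<noteq> d" and H: "H p b" "H p c" "H p d" using K by (auto simp: is_K4_def H_def)
  have "{b, c, d} \<subseteq> nbrs V H p" using H V by (auto simp: nbrs_def)
  moreover have c3: "card {b, c, d} = 3" using ne by simp
  ultimately show eq: "nbrs V H p = {b, c, d}"
    using card_nbrs_H_le_3[OF V(1)] finite_V by (intro card_seteq[symmetric]) auto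
  show "m p \<noteq> p"
  proof
    assume "m p = p"
    then show False using card_nbrs_H[OF V(1)] card_nbrs_minus_match[OF V(1)] eq c3 by simp
  qed
  then have "H p (m p)" by (auto simp: H_def)
  then show "m p \<in> {b, c, d}" using m_V[OF V(1)] eq by (auto simp: nbrs_def)
qed

text \<open>The partner \<open>q\<close> of \<open>p\<close> lies in the K4, so the other two
  vertices are partners as well. The four remaining edges are not matching edges and hence are
  opposite pairs.\<close>

lemma K4_square:
  assumes K: "is_K4 H p b c d" and V: "p \<in> V" "b \<in> V" "c \<in> V" "d \<in> V"
  shows "\<exists>q r s a\<^sub>1 a\<^sub>2 a\<^sub>3 a\<^sub>4. square p q r s a\<^sub>1 a\<^sub>2 a\<^sub>3 a\<^sub>4"
proof -
  have main: "\<exists>a\<^sub>1 a\<^sub>2 a\<^sub>3 a\<^sub>4. square p q r s a\<^sub>1 a\<^sub>2 a\<^sub>3 a\<^sub>4"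
    if K: "is_K4 H p q r s" and V: "q \<in> V" "r \<in> V" "s \<in> V" and q: "m p = q" for q r s
  proof -
    have K': "is_K4 H r p q s" using K symp_H by (auto simp: is_K4_def dest: sympD)
    have ne: "p \<noteq> q" "p \<noteq> r" "p \<noteq> s" "q \<noteq> r" "q \<noteq> s" "r \<noteq> s" using K by (auto simp: is_K4_def H_def)
    have "m r \<in> {p, q, s}" using K4_matched(2)[OF K' V(2) \<open>p \<in> V\<close> V(1,3)] .
    moreover have "m q = p" using q m_m by blast
    moreover have "m r \<noteq> p" "m r \<noteq> q" using \<open>m q = p\<close> q ne m_m by metis+
    ultimately have r: "m r = s" by blast
    have "m q \<noteq> s" "m q \<noteq> r" "m s \<noteq> p" using \<open>m q = p\<close> q r ne m_m by metis+
    moreover have "H p r" "H r q" "H q s" "H s p" using K symp_H by (auto simp: is_K4_def dest: sympD)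
    ultimately have "\<exists>x. opposite x p r" "\<exists>x. opposite x r q" "\<exists>x. opposite x q s" "\<exists>x. opposite x s p"
      using q r ne unfolding H_def by auto
    then show ?thesis using q r ne unfolding square_def by blast
  qed
  have Hs: "H u v \<Longrightarrow> H v u" for u v using symp_H by (auto dest: sympD)
  consider "m p = b" | "m p = c" | "m p = d" using K4_matched(2)[OF K V] by blast
  then show ?thesis
  proof cases
    case 1
    then show ?thesis using main[OF K V(2-4)] by blast
  next
    case 2
    have "is_K4 H p c b d" using K Hs by (auto simp: is_K4_def)
    then show ?thesis using main[of c b d] 2 V by blast
  next
    case 3
    have "is_K4 H p d b c" using K Hs by (auto simp: is_K4_def)
    then show ?thesis using main[of d b c] 3 V by blast
  qed
qed

section \<open>Squares that meet and squares that are isolated\<close>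

definition in_square :: "'a \<Rightarrow> bool" where
  "in_square p \<longleftrightarrow> (\<exists>q r s a b c d. square p q r s a b c d)"

lemma in_squareI:
  assumes "square p q r s a b c d"
  shows "in_square p" "in_square q" "in_square r" "in_square s"
  using assms square_flip[OF assms] square_swap[OF assms] square_swap[OF square_flip'[OF assms]]
  unfolding in_square_def by metis+

lemma in_square_match: "in_square (m p) \<longleftrightarrow> in_square p"
proof -
  have "in_square (m p)" if "in_square p" for p
    using that in_squareI(2) unfolding in_square_def square_def by metis
  then show ?thesis using m_m by metis
qed

lemma opposite_of_corner:
  assumes sq: "square p q r s a b c d" and x: "opposite p x w"
  shows "{x, w} = {a, d}"
proof -
  have "{x, w} = nbrs V E p - {m p}" using x by (simp add: opposite_def)
  also have "\<dots> = {a, d}" using nbrs_square_corner[OF sq] sq by (auto simp: square_def)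
  finally show ?thesis .
qed

text \<open>The pairs at the corners \<open>p\<close> and \<open>r\<close> of the first square are
  \<open>{a, d}\<close> and \<open>{a, b}\<close>, which forces \<open>r' = d\<close> and
  \<open>s' = b\<close>. Then \<open>b'\<close> is a neighbour of \<open>d\<close> other than
  \<open>m d = b\<close> and cannot be \<open>p\<close>; so it is \<open>s\<close>, and the pair
  \<open>{c, d}\<close> at \<open>s\<close> forces \<open>q' = c\<close>.\<close>

lemma square_diagonals_aux:
  assumes sq: "square p q r s a b c d" and sq': "square a q' r' s' p b' c' r"
  shows "m a = c" "m b = d"
proof -
  have o': "opposite p a r'" "opposite b' r' q'" "opposite r s' a" and m': "m a = q'" "m r' = s'" "a \<noteq> q'"
    using sq' by (auto simp: square_def)
  have "{a, r'} = {a, d}" using opposite_of_corner[OF sq o'(1)] .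
  then have r': "r' = d" by (auto simp: doubleton_eq_iff)
  have "{s', a} = {a, b}" using opposite_of_corner[OF square_swap[OF sq] o'(3)] .
  then have s': "s' = b" by (auto simp: doubleton_eq_iff)
  show "m b = d" using m'(2) r' s' m_m by metis
  have "opposite d s p" using sq by (simp add: square_def)
  then have "nbrs V E d \<subseteq> {b, s, p}" using nbrs_opposite m'(2) r' s' by metis
  moreover have "b' \<in> nbrs V E d" "b' \<noteq> b"
    using oppositeD[OF o'(2)] m'(2) r' s' by (auto simp: nbrs_def)
  ultimately have "b' = s \<or> b' = p" by auto
  moreover have "b' \<noteq> p"
  proof
    assume "b' = p"
    then have "{d, q'} = {a, d}" using opposite_of_corner[OF sq] o'(2) r' by blast
    then show False using m'(3) nbrs_square_corner(2)[OF sq] by (auto simp: doubleton_eq_iff)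
  qed
  ultimately have "opposite s d q'" using o'(2) r' by simp
  then have "{d, q'} = {c, d}" using opposite_of_corner[OF square_swap[OF square_flip'[OF sq]]] by blast
  then show "m a = c" using m'(1) by (auto simp: doubleton_eq_iff)
qed

text \<open>The neighbours of \<open>a\<close> other than \<open>m a\<close> are \<open>p\<close>
  and \<open>r\<close>, so a flip brings the second square into the position of
  \<open>square_diagonals_aux\<close>.\<close>

lemma square_diagonals:
  assumes sq: "square p q r s a b c d" and a: "in_square a"
  shows "m a = c" "m b = d"
proof -
  obtain q' r' s' a' b' c' d' where sq': "square a q' r' s' a' b' c' d'"
    using a unfolding in_square_def by blast
  have "nbrs V E a - {m a} = {p, r}" using sq by (simp add: square_def opposite_def)
  moreover have "nbrs V E a - {m a} = {a', d'}"
    using nbrs_square_corner[OF sq'] sq' by (auto simp: square_def)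
  ultimately consider "a' = p" "d' = r" | "a' = r" "d' = p" by (auto simp: doubleton_eq_iff)
  then have "\<exists>q' r' s' b' c'. square a q' r' s' p b' c' r"
    by cases (use sq' square_flip'[OF sq'] in metis)+
  then show "m a = c" "m b = d" using square_diagonals_aux[OF sq] by blast+
qed

(* If a lies in a K4 of H too, then a, b, c, d form that K4 and the eight vertices have no further
   neighbours, so they are the whole graph. *)
lemma limited_colouring_two_squares:
  assumes cut: "\<And>Q. \<not> one_edge_cut V E Q" and sq: "square p q r s a b c d" and a: "in_square a"
  shows "\<exists>c :: 'a \<Rightarrow> colour. limited_colouring V E c"
proof -
  let ?Q = "{p, q, r, s, a, b, c, d}"
  have m: "m p = q" "m q = p" "m r = s" "m s = r" "m a = c" "m c = a" "m b = d" "m d = b"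
    using sq square_diagonals[OF sq a] m_m unfolding square_def by metis+
  have opp: "opposite a p r" "opposite b r q" "opposite c q s" "opposite d s p" using sq by (auto simp: square_def)
  note sq2 = square_flip[OF sq] and sq3 = square_swap[OF sq] and sq4 = square_swap[OF square_flip'[OF sq]]
  have nb: "nbrs V E v \<subseteq> ?Q" if "v \<in> ?Q" for v
    using that nbrs_square_corner(1)[OF sq] nbrs_square_corner(1)[OF sq2] nbrs_square_corner(1)[OF sq3]
      nbrs_square_corner(1)[OF sq4] nbrs_opposite[OF opp(1)] nbrs_opposite[OF opp(2)]
      nbrs_opposite[OF opp(3)] nbrs_opposite[OF opp(4)] m by auto
  have "?Q \<subseteq> V" using square_V[OF sq] by auto
  moreover have "\<not> E u v" if "u \<in> ?Q" "v \<in> V - ?Q" for u v using nb[OF that(1)] that(2) by (auto simp: nbrs_def)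
  \<comment> \<open>A set without leaving edges also counts as a one-edge cut unless it is empty or
    all of \<open>V\<close>.\<close>
  ultimately have VQ: "V = ?Q" using cut[of ?Q] unfolding one_edge_cut_def by blast
  have ne: "p \<noteq> q" "p \<noteq> r" "p \<noteq> s" "q \<noteq> r" "q \<noteq> s" "r \<noteq> s" using square_neq[OF sq] .
  have ne1: "a \<noteq> b" "a \<noteq> c" "a \<noteq> d" "b \<noteq> c" "b \<noteq> d" "c \<noteq> d"
    using opposite_cases[OF opp(1), of r q] opposite_cases[OF opp(1), of q s] opposite_cases[OF opp(1), of s p]
      opposite_cases[OF opp(2), of q s] opposite_cases[OF opp(2), of s p] opposite_cases[OF opp(3), of s p]
      opp ne by (auto simp: doubleton_eq_iff)
  have ne2: "v \<notin> {p, q, r, s}" if "v \<in> {a, b, c, d}" for v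
  proof
    assume "v \<in> {p, q, r, s}"
    then have "m v \<in> {p, q, r, s}" using m by auto
    moreover have "m v \<in> {a, b, c, d}" using that m by auto
    moreover note oppositeD(9-14)[OF opp(1)] oppositeD(9-14)[OF opp(2)] oppositeD(9-14)[OF opp(3)] oppositeD(9-14)[OF opp(4)]
    ultimately show False using that \<open>v \<in> {p, q, r, s}\<close> m by auto
  qed
  \<comment> \<open>The only monochromatic opposite pairs are the red \<open>{p, r}\<close> at
    \<open>a\<close> and the blue \<open>{a, d}\<close> at \<open>p\<close>. Red is absent from
    \<open>a\<close> and \<open>m a = c\<close>, and blue from \<open>p\<close> and
    \<open>m p = q\<close>.\<close>
  define k where "k v = (if v \<in> {p, r, b} then Red else if v \<in> {q, c} then Green else Blue)" for v
  have k: "k p = Red" "k r = Red" "k b = Red" "k q = Green" "k c = Green" "k s = Blue" "k a = Blue" "k d = Blue"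
    using ne ne1 ne2[of a] ne2[of b] ne2[of c] ne2[of d] by (auto simp: k_def)
  have "limited_colouring V E k"
  proof (rule limited_colouringI)
    fix v assume "v \<in> V" "m v \<noteq> v"
    then have "v = p \<or> v = q \<or> v = r \<or> v = s \<or> v = a \<or> v = b \<or> v = c \<or> v = d" using VQ by blast
    then show "k v \<noteq> k (m v)" by (elim disjE) (simp_all add: m k)
  next
    fix x u w assume x: "opposite x u w"
    have *: "k u \<noteq> k w \<or> k u \<notin> {k x, k (m x)}" if "{u, w} = {y, z}" "k y \<noteq> k z \<or> k y \<notin> {k x, k (m x)}" for y z
      using that by (auto simp: doubleton_eq_iff)
    consider "x = p" | "x = q" | "x = r" | "x = s" | "x = a" | "x = b" | "x = c" | "x = d"
      using oppositeD(1)[OF x] VQ by blast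
    then show "k u \<noteq> k w \<or> k u \<notin> {k x, k (m x)}"
    proof cases
      case 1
      then show ?thesis using *[OF opposite_of_corner[OF sq]] x by (simp add: m k)
    next
      case 2
      then show ?thesis using *[OF opposite_of_corner[OF sq2]] x by (simp add: m k)
    next
      case 3
      then show ?thesis using *[OF opposite_of_corner[OF sq3]] x by (simp add: m k)
    next
      case 4
      then show ?thesis using *[OF opposite_of_corner[OF sq4]] x by (simp add: m k)
    next
      case 5
      then show ?thesis using *[OF opposite_cases[OF x]] opp(1) by (simp add: m k)
    next
      case 6
      then show ?thesis using *[OF opposite_cases[OF x]] opp(2) by (simp add: m k)
    next
      case 7
      then show ?thesis using *[OF opposite_cases[OF x]] opp(3) by (simp add: m k)
    next
      case 8
      then show ?thesis using *[OF opposite_cases[OF x]] opp(4) by (simp add: m k)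
    qed
  qed
  then show ?thesis by blast
qed

text \<open>Outside the squares, Brooks' theorem colours \<open>H\<close> properly. The squares are
  components of \<open>H\<close>, so they can be coloured one by one. The colour repeated on
  \<open>{p, r}\<close> has to avoid those of \<open>a\<close> and \<open>m a\<close>, which
  \<open>iso\<close> places outside all squares.\<close>

lemma ex_limited_colouring_isolated_squares:
  assumes iso: "\<And>p q r s a b c d. square p q r s a b c d \<Longrightarrow> \<not> in_square a"
  shows "\<exists>c :: 'a \<Rightarrow> colour. limited_colouring V E c"
proof -
  define W where "W = {v \<in> V. \<not> in_square v}"
  have "\<exists>c :: 'a \<Rightarrow> colour. proper_colouring W H c"
  proof (rule brooks_subcubic)
    show "finite W" using finite_V by (simp add: W_def)
    show "symp H" "irreflp H" by (rule symp_H irreflp_H)+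
    show "card (nbrs W H v) \<le> 3" if "v \<in> W" for v
    proof -
      have "card (nbrs W H v) \<le> card (nbrs V H v)"
        using finite_V by (intro card_mono nbrs_mono) (auto simp: W_def)
      also have "\<dots> \<le> 3" using that by (intro card_nbrs_H_le_3) (simp add: W_def)
      finally show ?thesis .
    qed
    show "\<not> is_K4 H a b c d" if "a \<in> W" "b \<in> W" "c \<in> W" "d \<in> W" for a b c d
    proof
      assume "is_K4 H a b c d"
      then have "in_square a" unfolding in_square_def using that by (intro K4_square) (auto simp: W_def)
      then show False using that by (simp add: W_def)
    qed
  qed
  then obtain c\<^sub>0 :: "'a \<Rightarrow> colour" where c0: "proper_colouring W H c\<^sub>0" by blast
  \<comment> \<open>Since \<open>a\<close> and \<open>m a\<close> are in no square, their colours
    under \<open>c\<^sub>0\<close> are final. The labelling of the square \<open>A\<close> is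
    existential because it is not determined by the set.\<close>
  define good where "good A g \<longleftrightarrow> (\<exists>p q r s a b c d. square p q r s a b c d \<and> A = {p, q, r, s} \<and>
    g p = g r \<and> g p \<notin> {c\<^sub>0 a, c\<^sub>0 (m a)} \<and> g q \<noteq> g p \<and> g s \<noteq> g p \<and> g q \<noteq> g s)"
    for A and g :: "'a \<Rightarrow> colour"
  have ex_good: "\<exists>g. good {p, q, r, s} g" if sq: "square p q r s a b c d" for p q r s a b c d
  proof -
    obtain t where t: "t \<noteq> c\<^sub>0 a" "t \<noteq> c\<^sub>0 (m a)" using ex_colour_neq2 by blast
    obtain k l where kl: "k \<noteq> t" "l \<noteq> t" "k \<noteq> l" using ex_three_colours by blast
    define g where "g = (\<lambda>_. t)(q := k, s := l)"
    have "g p = t" "g r = t" "g q = k" "g s = l" using square_neq[OF sq] by (auto simp: g_def)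
    then have "square p q r s a b c d \<and> {p, q, r, s} = {p, q, r, s} \<and> g p = g r \<and>
      g p \<notin> {c\<^sub>0 a, c\<^sub>0 (m a)} \<and> g q \<noteq> g p \<and> g s \<noteq> g p \<and> g q \<noteq> g s"
      using sq t kl by simp
    then show ?thesis unfolding good_def by blast
  qed
  \<comment> \<open>A square is the closed neighbourhood in \<open>H\<close> of each of its corners,
    so choosing \<open>g\<close> by \<open>block v\<close> gives the same \<open>g\<close> at all
    four.\<close>
  define block where "block v = insert v (nbrs V H v)" for v
  have block: "block v = {p, q, r, s}" if sq: "square p q r s a b c d" and v: "v \<in> {p, q, r, s}" for v p q r s a b c d
    using v H_square[OF sq] H_square[OF square_flip[OF sq]] H_square[OF square_swap[OF sq]]
      H_square[OF square_swap[OF square_flip'[OF sq]]] unfolding block_def by auto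
  define c where "c v = (if in_square v then (SOME g. good (block v) g) v else c\<^sub>0 v)" for v
  have cB: "\<exists>p q r s a b c' d g. square p q r s a b c' d \<and> v \<in> {p, q, r, s} \<and> (\<forall>u\<in>{p, q, r, s}. c u = g u) \<and>
    g p = g r \<and> g p \<notin> {c a, c (m a)} \<and> g q \<noteq> g p \<and> g s \<noteq> g p \<and> g q \<noteq> g s" if v: "in_square v" for v
  proof -
    define g where "g = (SOME g. good (block v) g)"
    have "\<exists>g. good (block v) g" using v ex_good block unfolding in_square_def by (metis insertI1)
    then have "good (block v) g" unfolding g_def by (rule someI_ex)
    then obtain p q r s a b c' d where sq: "square p q r s a b c' d" and A: "block v = {p, q, r, s}"
      and g: "g p = g r" "g p \<notin> {c\<^sub>0 a, c\<^sub>0 (m a)}" "g q \<noteq> g p" "g s \<noteq> g p" "g q \<noteq> g s"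
      unfolding good_def by blast
    have "v \<in> {p, q, r, s}" using A by (auto simp: block_def)
    moreover have "c u = g u" if "u \<in> {p, q, r, s}" for u
    proof -
      have "in_square u" using that in_squareI[OF sq] by auto
      moreover have "block u = block v" using block[OF sq that] A by simp
      ultimately show ?thesis by (simp add: c_def g_def)
    qed
    moreover have "\<not> in_square a" "\<not> in_square (m a)" using iso[OF sq] in_square_match by auto
    then have "c a = c\<^sub>0 a" "c (m a) = c\<^sub>0 (m a)" by (simp_all add: c_def)
    ultimately show ?thesis using sq g by metis
  qed
  have out: "c u \<noteq> c w" if "u \<in> V" "w \<in> V" "\<not> in_square u" "\<not> in_square w" "H u w" for u w
    using c0 that by (simp add: proper_colouring_def W_def c_def)
  have "limited_colouring V E c"
  proof (rule limited_colouringI)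
    fix v assume v: "v \<in> V" "m v \<noteq> v"
    show "c v \<noteq> c (m v)"
    proof (cases "in_square v")
      case True
      obtain p q r s a b c' d g where sq: "square p q r s a b c' d" and vA: "v \<in> {p, q, r, s}"
        and g: "\<forall>u\<in>{p, q, r, s}. c u = g u" "g p = g r" "g q \<noteq> g p" "g s \<noteq> g p"
        using cB[OF True] by blast
      have "m p = q" "m q = p" "m r = s" "m s = r" using sq m_m unfolding square_def by metis+
      then show ?thesis using vA g by auto
    next
      case False
      then show ?thesis using out[of v "m v"] v m_V in_square_match by (auto simp: H_def)
    qed
  next
    fix x u w assume x: "opposite x u w"
    have *: "c u \<noteq> c w \<or> c u \<notin> {c x, c (m x)}" if x: "opposite x u w" and u: "in_square u" for u w
    proof -
      obtain p q r s a b c' d g where sq: "square p q r s a b c' d" and uA: "u \<in> {p, q, r, s}"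
        and g: "\<forall>u\<in>{p, q, r, s}. c u = g u" "g p = g r" "g p \<notin> {c a, c (m a)}" "g q \<noteq> g p" "g s \<noteq> g p" "g q \<noteq> g s"
        using cB[OF u] by blast
      \<comment> \<open>Of the four pairs of the square only \<open>{p, r}\<close> at
        \<open>a\<close> is monochromatic, and its colour is absent from \<open>a\<close> and
        \<open>m a\<close>.\<close>
      show ?thesis
        using opposite_at_square[OF sq x uA] g unfolding doubleton_eq_iff by auto
    qed
    show "c u \<noteq> c w \<or> c u \<notin> {c x, c (m x)}"
    proof (cases "in_square u \<or> in_square w")
      case True
      then show ?thesis using *[OF x] *[OF opposite_sym[OF x]] by auto
    next
      case False
      then show ?thesis using out[of u w] oppositeD[OF x] x by (auto simp: H_def)
    qed
  qed
  then show ?thesis by blast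
qed

end

text \<open>A degree bound instead of 3-regularity makes the induction possible, since the two sides
  of a one-edge cut are coloured separately.\<close>

theorem ex_limited_colouring:
  fixes E :: "'a \<Rightarrow> 'a \<Rightarrow> bool"
  assumes "finite V" "symp E" "irreflp E" "\<And>v. v \<in> V \<Longrightarrow> card (nbrs V E v) \<le> 3"
  shows "\<exists>c :: 'a \<Rightarrow> colour. limited_colouring V E c"
  using assms(1,4)
proof (induction V rule: finite_psubset_induct)
  case (psubset V)
  show ?case
  proof (cases "\<exists>Q. one_edge_cut V E Q")
    case True
    then obtain Q where Q: "one_edge_cut V E Q" by blast
    have IH: "\<exists>c :: 'a \<Rightarrow> colour. limited_colouring U E c" if U: "U \<subset> V" for U
    proof (rule psubset.IH[OF U])
      fix v assume "v \<in> U"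
      then have "card (nbrs V E v) \<le> 3" using psubset.prems U by blast
      moreover have "card (nbrs U E v) \<le> card (nbrs V E v)"
        using U psubset.hyps by (intro card_mono nbrs_mono) auto
      ultimately show "card (nbrs U E v) \<le> 3" by linarith
    qed
    have "Q \<subset> V" "V - Q \<subset> V" using Q by (auto simp: one_edge_cut_def)
    then obtain c\<^sub>1 c\<^sub>2 :: "'a \<Rightarrow> colour" where c: "limited_colouring Q E c\<^sub>1" "limited_colouring (V - Q) E c\<^sub>2"
      using IH[of Q] IH[of "V - Q"] by blast
    show ?thesis by (rule limited_colouring_join[OF psubset.hyps(1) assms(2,3) psubset.prems Q c])
  next
    case False
    then have cut: "\<not> one_edge_cut V E Q" for Q by blast
    obtain m where m: "\<And>v. m (m v) = v"
      "\<And>v. v \<in> V \<Longrightarrow> m v \<in> V \<and> (m v \<noteq> v \<longrightarrow> E v (m v)) \<and> (m v = v \<longrightarrow> card (nbrs V E v) \<le> 2)"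
      using ex_matching_covering_cubic[OF psubset.hyps(1) assms(2,3) psubset.prems cut] by blast
    interpret subcubic_matching V E m
      using psubset.hyps(1) assms(2,3) psubset.prems m by unfold_locales auto
    show ?thesis
    proof (cases "\<exists>p q r s a b c d. square p q r s a b c d \<and> in_square a")
      case True
      then show ?thesis using limited_colouring_two_squares[OF cut] by blast
    next
      case False
      then show ?thesis by (intro ex_limited_colouring_isolated_squares) blast
    qed
  qed
qed

section \<open>From the colouring to the signed dominating function\<close>

lemma card_no_triple_class:
  assumes "no_triple c S"
  shows "card {u \<in> S. c u = k} \<le> 2"
proof (rule ccontr)
  assume "\<not> card {u \<in> S. c u = k} \<le> 2"
  then have "3 \<le> card {u \<in> S. c u = k}" by simp
  then obtain T where T: "T \<subseteq> {u \<in> S. c u = k}" "card T = 3" "finite T" by (rule obtain_subset_with_card_n)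
  then obtain x y z where xyz: "T = {x, y, z}" "x \<noteq> y" "x \<noteq> z" "y \<noteq> z"
    by (auto simp: card_Suc_eq numeral_3_eq_3)
  then have "x \<in> S" "y \<in> S" "z \<in> S" "c x = c y" "c x = c z" using T(1) by auto
  with xyz(2-4) assms(1) show False unfolding no_triple_def by blast
qed

theorem theorem2p3:
  fixes G :: "'a pair_pre_digraph" and n :: nat
  assumes "pair_graph G"
    and "regular 3 G"
    and "card (pverts G) = n"
  shows "nnsd_number G \<le> real n / 3"
proof -
  interpret pair_graph G by fact
  define V E where "V = pverts G" and "E = (\<lambda>u v. (u, v) \<in> parcs G)"
  have fin: "finite V" by (simp add: V_def)
  have symE: "symp E" using arcs_symmetric by (auto simp: E_def symp_def)
  have irrE: "irreflp E"
  proof (rule irreflpI)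
    fix v
    show "\<not> E v v" using pair_no_loops[of "(v, v)"] by (auto simp: E_def)
  qed
  have nbrs: "nbrs V E v = open_nbhd G v" for v
    using in_arcsD2 by (auto simp: nbrs_def open_nbhd_def V_def E_def)
  have deg: "card (nbrs V E v) = 3" if "v \<in> V" for v
    using assms(2) that unfolding nbrs regular_def out_degree_eq_card_open_nbhd by (simp add: V_def)
  obtain c :: "'a \<Rightarrow> colour" where c: "limited_colouring V E c"
    using ex_limited_colouring[OF fin symE irrE] deg by (metis order_refl)
  let ?C = "\<lambda>k. {u \<in> V. c u = k}"
  have "V = ?C Red \<union> (?C Green \<union> ?C Blue)" using colour.exhaust by blast
  then have "card V = card (?C Red \<union> (?C Green \<union> ?C Blue))" by simp
  also have "\<dots> \<le> card (?C Red) + (card (?C Green) + card (?C Blue))"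
    by (meson card_Un_le add_left_mono le_trans)
  finally have "card V \<le> card (?C Red) + (card (?C Green) + card (?C Blue))" .
  then have "card V \<le> 3 * card (?C Red) \<or> card V \<le> 3 * card (?C Green) \<or> card V \<le> 3 * card (?C Blue)"
    by linarith
  then obtain k where k: "card V \<le> 3 * card (?C k)" by blast
  define f where "f u = (if u \<in> ?C k then - 1 else 1 :: real)" for u
  have sum_f: "sum f S = real (card S) - 2 * real (card {u \<in> S. c u = k})" if "S \<subseteq> V" for S
  proof -
    have S: "finite S" using that fin finite_subset by blast
    have "sum f S = (\<Sum>u\<in>S. 1 - 2 * (if c u = k then 1 else 0))"
      using that by (intro sum.cong) (auto simp: f_def)
    also have "\<dots> = real (card S) - 2 * (\<Sum>u\<in>S. if c u = k then 1 else 0)"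
      by (simp add: sum_subtractf sum_distrib_left)
    also have "(\<Sum>u\<in>S. if c u = k then 1 else 0) = real (card {u \<in> S. c u = k})"
      using S by (simp add: sum.If_cases Int_def)
    finally show ?thesis .
  qed
  have "nnsdf G f"
    unfolding nnsdf_def
  proof (intro conjI ballI)
    show "f \<in> pverts G \<rightarrow> {- 1, 1}" by (auto simp: f_def)
    fix v assume "v \<in> pverts G"
    then have v: "v \<in> V" by (simp add: V_def)
    have S: "closed_nbhd G v = insert v (nbrs V E v)" by (simp add: closed_nbhd_def nbrs)
    then have sub: "closed_nbhd G v \<subseteq> V" using v by (auto simp: nbrs_def)
    have "v \<notin> nbrs V E v" using irrE by (auto simp: nbrs_def irreflp_def)
    \<comment> \<open>Of the four vertices of \<open>N[v]\<close> at most two have the colour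
      \<open>k\<close>, so at most two values are \<open>-1\<close>.\<close>
    then have "card (closed_nbhd G v) = 4" using deg[OF v] fin S by simp
    moreover have "card {u \<in> closed_nbhd G v. c u = k} \<le> 2"
      using c v S unfolding limited_colouring_def by (intro card_no_triple_class) auto
    ultimately show "0 \<le> sum f (closed_nbhd G v)" unfolding sum_f[OF sub] by simp
  qed
  then have "nnsd_number G \<le> sum f V" using nnsd_number_le[OF assms(1)] by (simp add: V_def)
  also have "\<dots> = real (card V) - 2 * real (card (?C k))" by (intro sum_f) simp
  also have "\<dots> \<le> real n / 3" using k assms(3) by (simp add: V_def)
  finally show ?thesis .
qed

end
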